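(* A simply laced Coxeter group $W$ has finitely many freely braided elements if and only if it has finitely many fully commutative elements.
   Context: $W$ is a Coxeter group with generators $\{s_i : i\in I\}$ and Coxeter matrix $(m_{ij})$, simply laced meaning $m_{ij}\in\{2,3\}$ for $i\neq j$. Words are elements of $I^*$; a word $i_1\cdots i_n$ represents $s_{i_1}\cdots s_{i_n}$ and is reduced if $n$ is minimal. With $V$, basis $\{\alpha_i\}$, form $B(\alpha_i,\alpha_j)=-\cos(\pi/m_{ij})$ and action $s_i\alpha_j=\alpha_j-2B(\alpha_j,\alpha_i)\alpha_i$, let $\Phi=\{w\alpha_i\}$, $\Phi^+$ its elements with nonnegative coefficients, $\Phi^-=-\Phi^+$, $\Phi(w)=\Phi^+\cap w^{-1}(\Phi^-)$. The root sequence of a reduced expression $i_1\cdots i_n$ is $(r_1,\dots,r_n)$, $r_1=\alpha_{i_n}$, $r_l=s_{i_n}\cdots s_{i_{n-l+2}}(\alpha_{i_{n-l+1}})$. An inversion triple of $w$ is a subset $\{\alpha,\beta,\alpha+\beta\}\subseteq\Phi(w)$; it is contractible if its elements appear consecutively in some root sequence for $w$; $w$ is freely braided if its contractible inversion triples are pairwise disjoint. Two words are commutation equivalent if related by substitutions $\mathbf{u}ij\mathbf{v}\to\mathbf{u}ji\mathbf{v}$ with $m_{ij}=2$; $w$ is fully commutative if all its reduced expressions are commutation equivalent. *)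

theory Defs
  imports Complex_Main "HOL-Algebra.Group" "HOL-Library.Poly_Mapping"
begin

section \<open>Coxeter groups given by a presentation\<close>

definition word_prod :: "('g, 'b) monoid_scheme \<Rightarrow> ('i \<Rightarrow> 'g) \<Rightarrow> 'i list \<Rightarrow> 'g" where
  "word_prod G s u = foldr (\<lambda>i x. s i \<otimes>\<^bsub>G\<^esub> x) u \<one>\<^bsub>G\<^esub>"

text \<open>
  Entries of a Coxeter matrix are natural numbers, where \<open>0\<close> encodes \<open>\<infinity>\<close>. The congruence on words
  generated by the Coxeter relations \<open>(s\<^sub>i s\<^sub>j)\<^bsup>m i j\<^esup> = 1\<close> is used below to express that the group
  is presented by these relations. Formal inverses of generators are not needed, because
  \<open>m i i = 1\<close> yields the relation \<open>s\<^sub>i s\<^sub>i = 1\<close>. For \<open>m i j = 0\<close> the relation is void.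
\<close>

inductive coxeter_equiv :: "'i set \<Rightarrow> ('i \<Rightarrow> 'i \<Rightarrow> nat) \<Rightarrow> 'i list \<Rightarrow> 'i list \<Rightarrow> bool"
  for I :: "'i set" and m :: "'i \<Rightarrow> 'i \<Rightarrow> nat" where
  refl: "u \<in> lists I \<Longrightarrow> coxeter_equiv I m u u"
| sym: "coxeter_equiv I m u v \<Longrightarrow> coxeter_equiv I m v u"
| trans: "coxeter_equiv I m u v \<Longrightarrow> coxeter_equiv I m v w \<Longrightarrow> coxeter_equiv I m u w"
| relator: "u \<in> lists I \<Longrightarrow> v \<in> lists I \<Longrightarrow> i \<in> I \<Longrightarrow> j \<in> I \<Longrightarrow>
    coxeter_equiv I m (u @ concat (replicate (m i j) [i, j]) @ v) (u @ v)"

locale coxeter_system = group G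
  for G :: "('g, 'b) monoid_scheme" (structure) +
  fixes I :: "'i set" and m :: "'i \<Rightarrow> 'i \<Rightarrow> nat" and s :: "'i \<Rightarrow> 'g"
  assumes m_diag: "i \<in> I \<Longrightarrow> m i i = 1"
    and m_sym: "i \<in> I \<Longrightarrow> j \<in> I \<Longrightarrow> m i j = m j i"
    and m_off_diag: "i \<in> I \<Longrightarrow> j \<in> I \<Longrightarrow> i \<noteq> j \<Longrightarrow> m i j \<noteq> 1"
    and gen_closed: "s \<in> I \<rightarrow> carrier G"
    and generated: "carrier G = word_prod G s ` lists I"
    and presented: "u \<in> lists I \<Longrightarrow> v \<in> lists I \<Longrightarrow>
      word_prod G s u = word_prod G s v \<longleftrightarrow> coxeter_equiv I m u v"

definition simply_laced :: "'i set \<Rightarrow> ('i \<Rightarrow> 'i \<Rightarrow> nat) \<Rightarrow> bool" where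
  "simply_laced I m \<longleftrightarrow> (\<forall>i\<in>I. \<forall>j\<in>I. i \<noteq> j \<longrightarrow> m i j \<in> {2, 3})"


section \<open>The geometric representation\<close>

text \<open>
  A vector is a finitely supported family of coefficients, so that \<open>Poly_Mapping.single i c\<close> is
  \<open>c \<alpha>\<^sub>i\<close>. The space \<open>V\<close> consists of the vectors whose support lies in \<open>I\<close>.
  For \<open>m i j = 0\<close> (that is, \<open>\<infinity>\<close>) we have \<open>pi / 0 = 0\<close>, so the form takes the usual value \<open>-1\<close>.
\<close>

definition simple_root :: "'i \<Rightarrow> ('i \<Rightarrow>\<^sub>0 real)" where
  "simple_root i = Poly_Mapping.single i 1"

definition coxeter_form ::
    "('i \<Rightarrow> 'i \<Rightarrow> nat) \<Rightarrow> ('i \<Rightarrow>\<^sub>0 real) \<Rightarrow> ('i \<Rightarrow>\<^sub>0 real) \<Rightarrow> real" where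
  "coxeter_form m x y = (\<Sum>i\<in>Poly_Mapping.keys x. \<Sum>j\<in>Poly_Mapping.keys y.
     Poly_Mapping.lookup x i * Poly_Mapping.lookup y j * (- cos (pi / real (m i j))))"

definition simple_reflection ::
    "('i \<Rightarrow> 'i \<Rightarrow> nat) \<Rightarrow> 'i \<Rightarrow> ('i \<Rightarrow>\<^sub>0 real) \<Rightarrow> ('i \<Rightarrow>\<^sub>0 real)" where
  "simple_reflection m i x = x - Poly_Mapping.single i (2 * coxeter_form m x (simple_root i))"

definition word_action ::
    "('i \<Rightarrow> 'i \<Rightarrow> nat) \<Rightarrow> 'i list \<Rightarrow> ('i \<Rightarrow>\<^sub>0 real) \<Rightarrow> ('i \<Rightarrow>\<^sub>0 real)" where
  "word_action m u x = foldr (simple_reflection m) u x"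

text \<open>\<open>r\<^sub>l\<close> is obtained by reading the word from its right end.\<close>

definition root_sequence :: "('i \<Rightarrow> 'i \<Rightarrow> nat) \<Rightarrow> 'i list \<Rightarrow> ('i \<Rightarrow>\<^sub>0 real) list" where
  "root_sequence m u =
     map (\<lambda>l. word_action m (take l (rev u)) (simple_root (rev u ! l))) [0..<length u]"

inductive commutation_step :: "'i set \<Rightarrow> ('i \<Rightarrow> 'i \<Rightarrow> nat) \<Rightarrow> 'i list \<Rightarrow> 'i list \<Rightarrow> bool"
  for I :: "'i set" and m :: "'i \<Rightarrow> 'i \<Rightarrow> nat" where
  "u \<in> lists I \<Longrightarrow> v \<in> lists I \<Longrightarrow> i \<in> I \<Longrightarrow> j \<in> I \<Longrightarrow> m i j = 2 \<Longrightarrow>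
    commutation_step I m (u @ [i, j] @ v) (u @ [j, i] @ v)"

definition commutation_equivalent ::
    "'i set \<Rightarrow> ('i \<Rightarrow> 'i \<Rightarrow> nat) \<Rightarrow> 'i list \<Rightarrow> 'i list \<Rightarrow> bool" where
  "commutation_equivalent I m = (commutation_step I m)\<^sup>*\<^sup>*"


context coxeter_system
begin

definition reduced :: "'i list \<Rightarrow> bool" where
  "reduced u \<longleftrightarrow> u \<in> lists I \<and>
     (\<forall>v\<in>lists I. word_prod G s v = word_prod G s u \<longrightarrow> length u \<le> length v)"

definition reduced_expression :: "'i list \<Rightarrow> 'g \<Rightarrow> bool" where
  "reduced_expression u w \<longleftrightarrow> reduced u \<and> word_prod G s u = w"

text \<open>
  The choice of the word is immaterial; see \<open>action_word_prod\<close> below for the simply laced case.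
\<close>

definition action :: "'g \<Rightarrow> ('i \<Rightarrow>\<^sub>0 real) \<Rightarrow> ('i \<Rightarrow>\<^sub>0 real)" where
  "action w = word_action m (SOME u. u \<in> lists I \<and> word_prod G s u = w)"

definition roots :: "('i \<Rightarrow>\<^sub>0 real) set" where
  "roots = {action w (simple_root i) | w i. w \<in> carrier G \<and> i \<in> I}"

definition pos_roots :: "('i \<Rightarrow>\<^sub>0 real) set" where
  "pos_roots = {x \<in> roots. \<forall>i. 0 \<le> Poly_Mapping.lookup x i}"

definition neg_roots :: "('i \<Rightarrow>\<^sub>0 real) set" where
  "neg_roots = uminus ` pos_roots"

definition inversion_set :: "'g \<Rightarrow> ('i \<Rightarrow>\<^sub>0 real) set" where
  "inversion_set w = pos_roots \<inter> action (inv w) ` neg_roots"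

definition inversion_triple :: "'g \<Rightarrow> ('i \<Rightarrow>\<^sub>0 real) set \<Rightarrow> bool" where
  "inversion_triple w T \<longleftrightarrow> (\<exists>a b. T = {a, b, a + b}) \<and> T \<subseteq> inversion_set w"

definition contractible :: "'g \<Rightarrow> ('i \<Rightarrow>\<^sub>0 real) set \<Rightarrow> bool" where
  "contractible w T \<longleftrightarrow> (\<exists>u xs ys zs. reduced_expression u w \<and>
     root_sequence m u = xs @ ys @ zs \<and> length ys = 3 \<and> set ys = T)"

definition freely_braided :: "'g \<Rightarrow> bool" where
  "freely_braided w \<longleftrightarrow> pairwise disjnt {T. inversion_triple w T \<and> contractible w T}"

definition fully_commutative :: "'g \<Rightarrow> bool" where
  "fully_commutative w \<longleftrightarrow> (\<forall>u v. reduced_expression u w \<longrightarrow> reduced_expression v w \<longrightarrow>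
     commutation_equivalent I m u v)"

end

lemma coxeter_form_simple_root:
  assumes "finite A" "Poly_Mapping.keys x \<subseteq> A"
  shows "coxeter_form m x (simple_root j) =
    (\<Sum>i\<in>A. Poly_Mapping.lookup x i * (- cos (pi / real (m i j))))"
proof -
  have "coxeter_form m x (simple_root j) =
      (\<Sum>i\<in>Poly_Mapping.keys x. Poly_Mapping.lookup x i * (- cos (pi / real (m i j))))"
    by (simp add: coxeter_form_def simple_root_def)
  also have "\<dots> = (\<Sum>i\<in>A. Poly_Mapping.lookup x i * (- cos (pi / real (m i j))))"
    using assms by (intro sum.mono_neutral_left) (auto simp: in_keys_iff)
  finally show ?thesis .
qed

lemma coxeter_form_diff:
  "coxeter_form m (x - y) (simple_root j) =
    coxeter_form m x (simple_root j) - coxeter_form m y (simple_root j)"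
proof -
  let ?A = "Poly_Mapping.keys x \<union> Poly_Mapping.keys y"
  have "Poly_Mapping.keys (x - y) \<subseteq> ?A"
    by (auto simp: in_keys_iff lookup_minus)
  then show ?thesis
    by (simp add: coxeter_form_simple_root[where A = ?A] lookup_minus left_diff_distrib
        sum_subtractf sum_negf)
qed

lemma coxeter_form_single:
  "coxeter_form m (Poly_Mapping.single i c) (simple_root j) = - c * cos (pi / real (m i j))"
  by (simp add: coxeter_form_simple_root[where A = "{i}"])

context coxeter_system
begin

lemma word_action_relator:
  assumes sl: "simply_laced I m" and i: "i \<in> I" and j: "j \<in> I"
  shows "word_action m (concat (replicate (m i j) [i, j])) x = x"
proof -
  define f where "f k y = coxeter_form m y (simple_root k)" for k y
  define r where "r = simple_reflection m"
  have lookup_r: "Poly_Mapping.lookup (r k y) l =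
      Poly_Mapping.lookup y l - (if k = l then 2 * f k y else 0)" for k l y
    by (simp add: r_def f_def simple_reflection_def lookup_minus lookup_single when_def)
  have f_r: "f l (r k y) = f l y + 2 * f k y * cos (pi / real (m k l))" for k l y
    by (simp add: r_def f_def simple_reflection_def coxeter_form_diff coxeter_form_single)
  have f_diag: "f i (r i y) = - f i y" "f j (r j y) = - f j y" for y
    by (simp_all add: f_r m_diag[OF i] m_diag[OF j])
  consider "i = j" | "i \<noteq> j" "m i j = 2" "m j i = 2" | "i \<noteq> j" "m i j = 3" "m j i = 3"
  proof -
    have "i \<noteq> j \<Longrightarrow> m i j = 2 \<or> m i j = 3"
      using sl i j by (simp add: simply_laced_def)
    then show ?thesis
      using that m_sym[OF i j] by metis
  qed
  then show ?thesis
  proof cases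
    case 1
    have "concat (replicate (m i j) [i, j]) = [j, j]"
      using 1 m_diag[OF j] by simp
    then have "word_action m (concat (replicate (m i j) [i, j])) x = r j (r j x)"
      by (simp add: word_action_def r_def)
    also have "\<dots> = x"
      by (intro poly_mapping_eqI) (simp only: lookup_r f_diag, simp)
    finally show ?thesis .
  next
    case 2
    have f_off: "f i (r j y) = f i y" "f j (r i y) = f j y" for y
      by (simp_all add: f_r 2)
    have "concat (replicate (m i j) [i, j]) = [i, j, i, j]"
      using 2 by (simp add: numeral_2_eq_2)
    then have "word_action m (concat (replicate (m i j) [i, j])) x = r i (r j (r i (r j x)))"
      by (simp add: word_action_def r_def)
    also have "\<dots> = x"
      by (intro poly_mapping_eqI) (simp only: lookup_r f_diag f_off, simp)
    finally show ?thesis .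
  next
    case 3
    have f_off: "f i (r j y) = f i y + f j y" "f j (r i y) = f j y + f i y" for y
      by (simp_all add: f_r 3 cos_60)
    have "concat (replicate (m i j) [i, j]) = [i, j, i, j, i, j]"
      using 3 by (simp add: numeral_3_eq_3)
    then have "word_action m (concat (replicate (m i j) [i, j])) x =
        r i (r j (r i (r j (r i (r j x)))))"
      by (simp add: word_action_def r_def)
    also have "\<dots> = x"
      by (intro poly_mapping_eqI) (simp only: lookup_r f_diag f_off, simp)
    finally show ?thesis .
  qed
qed

lemma word_action_cong:
  assumes "simply_laced I m" "coxeter_equiv I m u v"
  shows "word_action m u = word_action m v"
  using assms(2)
proof induction
  case (refl u)
  show ?case by (rule HOL.refl)
next
  case (sym u v)
  from sym.IH show ?case by (rule HOL.sym)
next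
  case (trans u v w)
  from trans.IH show ?case by (rule HOL.trans)
next
  case (relator u v i j)
  have append: "word_action m (a @ b) x = word_action m a (word_action m b x)" for a b x
    by (simp add: word_action_def)
  show ?case
    by (rule ext) (simp only: append word_action_relator[OF assms(1) relator(3,4)])
qed

lemma action_word_prod:
  assumes "simply_laced I m" "u \<in> lists I"
  shows "action (word_prod G s u) = word_action m u"
proof -
  let ?v = "SOME v. v \<in> lists I \<and> word_prod G s v = word_prod G s u"
  have "?v \<in> lists I \<and> word_prod G s ?v = word_prod G s u"
    by (rule someI[where x = u]) (simp add: assms(2) del: in_lists_conv_set)
  then have "coxeter_equiv I m ?v u"
    using presented[of ?v u] assms(2) by simp
  then show ?thesis
    unfolding action_def by (rule word_action_cong[OF assms(1)])
qed

end

end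

theory Submission imports Defs begin

text \<open>
  A fully commutative element has no contractible inversion triple at all, because such a triple
  comes from a factor \<open>iji\<close> of a reduced word. Conversely, take any reduced word of a freely
  braided element and consider the pairs of consecutive occurrences of a letter \<open>i\<close> with exactly
  one letter between them that is joined to \<open>i\<close>. Each pair gives a contractible triple, so the
  triples of positions arising in this way are disjoint. Deleting one end of each pair leaves at
  least half of the word, and freely braidedness forces at least two neighbours of \<open>i\<close> between
  consecutive occurrences of \<open>i\<close> in what remains: otherwise braiding some of the triples would
  bring up a further triple that meets one of them. By Matsumoto's theorem a word of that shape is
  reduced and represents a fully commutative element. Hence a bound on the length of fully
  commutative elements doubles to a bound for freely braided ones.
\<close>

section \<open>Thinning out words\<close>

text \<open>The thinned word generally represents another element, about which free braidedness says
  nothing. Every contradiction is therefore reached in the full labelled word, where a gap between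
  two kept occurrences of \<open>i\<close> can still hide deleted letters. Since it is always the
  right end of a pair that is deleted, a deleted neighbour of \<open>i\<close> in the gap has its
  partner either inside the gap, and then kept, or to the left of it, and then the left end of the
  gap is the middle letter of that pair; these two possibilities govern the case analysis. Labelling
  by roots makes triples found in different reduced words comparable: a move only permutes the
  labels, so a triple that appears after braiding can be tested against those of the original word.
  Finally, a length bound yields finiteness only over a finite alphabet; the alphabet is finite
  because the generators are themselves fully commutative.\<close>

lemma upt_split: "a \<le> p \<Longrightarrow> p < b \<Longrightarrow> [a..<b] = [a..<p] @ p # [Suc p..<b]"
  by (metis less_imp_le_nat upt_add_eq_append upt_conv_Cons le_iff_add)

lemma filter_upt_consecutive:
  assumes "filter P [0..<n] = us @ x # y # vs"
  shows "x < y \<and> y < n \<and> P x \<and> P y \<and> (\<forall>z. x < z \<longrightarrow> z < y \<longrightarrow> \<not> P z)"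
proof -
  have "sorted_wrt (<) (us @ x # y # vs)"
    unfolding assms[symmetric] by (simp add: sorted_wrt_filter)
  then have s: "x < y" "\<And>z. z \<in> set us \<Longrightarrow> z < x" "\<And>z. z \<in> set vs \<Longrightarrow> y < z"
    by (auto simp: sorted_wrt_append)
  have set: "set (us @ x # y # vs) = {z. z < n \<and> P z}"
    unfolding assms[symmetric] by auto
  have "x \<in> {z. z < n \<and> P z}" "y \<in> {z. z < n \<and> P z}"
    unfolding set[symmetric] by simp_all
  then have mem: "y < n" "P x" "P y"
    by simp_all
  have "\<not> P z" if "x < z" "z < y" for z
  proof
    assume "P z"
    then have "z \<in> set (us @ x # y # vs)"
      unfolding set using that(2) mem(1) by simp
    then show False
      using s(2)[of z] s(3)[of z] that by auto
  qed
  then show ?thesis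
    using s(1) mem by blast
qed

text \<open>
  In a well spaced word, at least two neighbours of \<open>i\<close> lie between consecutive occurrences of
  \<open>i\<close>. This is phrased in terms of a pattern because commutations preserve the pattern.
\<close>

definition pattern :: "('i \<Rightarrow> 'i \<Rightarrow> bool) \<Rightarrow> 'i \<Rightarrow> 'i list \<Rightarrow> bool list" where
  "pattern adj i u = map (\<lambda>k. k = i) (filter (\<lambda>k. k = i \<or> adj i k) u)"

definition well_spaced :: "('i \<Rightarrow> 'i \<Rightarrow> bool) \<Rightarrow> 'i list \<Rightarrow> bool" where
  "well_spaced adj u \<longleftrightarrow> (\<forall>i a c. pattern adj i u \<noteq> a @ [True, True] @ c \<and>
     pattern adj i u \<noteq> a @ [True, False, True] @ c)"

text \<open>
  To be instantiated with the reduced words of a freely braided element, where each letter is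
  labelled with its root. The last assumption is the disjointness of contractible triples.
\<close>

locale braid_closed =
  fixes adj :: "'i \<Rightarrow> 'i \<Rightarrow> bool" and \<L> :: "('i \<times> 'a) list set"
  assumes adj_irrefl: "\<not> adj i i"
    and adj_sym: "adj i j \<Longrightarrow> adj j i"
    and commute: "A @ (i, a) # (j, b) # E \<in> \<L> \<Longrightarrow> i \<noteq> j \<Longrightarrow> \<not> adj i j \<Longrightarrow> A @ (j, b) # (i, a) # E \<in> \<L>"
    and braid: "A @ (i, a) # (j, b) # (i, c) # E \<in> \<L> \<Longrightarrow> adj i j \<Longrightarrow>
      A @ (j, c) # (i, b) # (j, a) # E \<in> \<L>"
    and square_free: "A @ (i, a) # (i, b) # E \<notin> \<L>"
    and distinct_labels: "L \<in> \<L> \<Longrightarrow> distinct (map snd L)"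
    and disjoint: "A @ (i, a) # (j, b) # (i, c) # E \<in> \<L> \<Longrightarrow> adj i j \<Longrightarrow>
      A' @ (i', a') # (j', b') # (i', c') # E' \<in> \<L> \<Longrightarrow> adj i' j' \<Longrightarrow>
      {a, b, c} \<inter> {a', b', c'} \<noteq> {} \<Longrightarrow> {a, b, c} = {a', b', c'}"
begin

section \<open>Triples and commutations in labelled words\<close>

definition commuting :: "'i \<Rightarrow> 'i \<Rightarrow> bool" where
  "commuting i j \<longleftrightarrow> i \<noteq> j \<and> \<not> adj i j"

definition triple :: "'a set \<Rightarrow> bool" where
  "triple T \<longleftrightarrow> (\<exists>A i a j b c E. T = {a, b, c} \<and> adj i j \<and> A @ (i, a) # (j, b) # (i, c) # E \<in> \<L>)"

lemma tripleI: "A @ (i, a) # (j, b) # (i, c) # E \<in> \<L> \<Longrightarrow> adj i j \<Longrightarrow> triple {a, b, c}"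
  unfolding triple_def by blast

lemma triple_eq:
  assumes "triple T" "triple T'" "x \<in> T" "x \<in> T'"
  shows "T = T'"
proof -
  obtain A i a j b c E where T: "T = {a, b, c}" "adj i j" "A @ (i, a) # (j, b) # (i, c) # E \<in> \<L>"
    using assms(1) unfolding triple_def by blast
  obtain A' i' a' j' b' c' E' where T': "T' = {a', b', c'}" "adj i' j'"
      "A' @ (i', a') # (j', b') # (i', c') # E' \<in> \<L>"
    using assms(2) unfolding triple_def by blast
  show ?thesis
    unfolding T(1) T'(1)
    by (rule disjoint[OF T(3,2) T'(3,2)]) (use assms(3,4) T(1) T'(1) in blast)
qed

lemma shift_right:
  "A @ x # R @ E \<in> \<L> \<Longrightarrow> \<forall>y\<in>set R. commuting (fst x) (fst y) \<Longrightarrow> A @ R @ x # E \<in> \<L>"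
proof (induction R arbitrary: A)
  case (Cons y R)
  have "A @ y # x # R @ E \<in> \<L>"
    using Cons.prems commute[of A "fst x" "snd x" "fst y" "snd y" "R @ E"]
    by (simp add: commuting_def)
  then show ?case
    using Cons.IH[of "A @ [y]"] Cons.prems by simp
qed simp

lemma shift_left:
  "A @ R @ x # E \<in> \<L> \<Longrightarrow> \<forall>y\<in>set R. commuting (fst x) (fst y) \<Longrightarrow> A @ x # R @ E \<in> \<L>"
proof (induction R arbitrary: E rule: rev_induct)
  case (snoc y R)
  have "A @ R @ x # y # E \<in> \<L>"
    using snoc.prems commute[of "A @ R" "fst y" "snd y" "fst x" "snd x" E]
      adj_sym[of "fst y" "fst x"] by (simp add: commuting_def) metis
  then show ?case
    using snoc.IH[of "y # E"] snoc.prems by simp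
qed simp

lemma gather:
  assumes "A @ (i, a) # R @ x # S @ (i, c) # E \<in> \<L>"
    and "\<forall>y\<in>set R \<union> set S. commuting i (fst y)"
  shows "A @ R @ (i, a) # x # (i, c) # S @ E \<in> \<L>"
proof -
  have "A @ R @ (i, a) # x # S @ (i, c) # E \<in> \<L>"
    using shift_right[of A "(i, a)" R "x # S @ (i, c) # E"] assms by simp
  then show ?thesis
    using shift_left[of "A @ R @ [(i, a), x]" S "(i, c)" E] assms(2) by simp
qed

text \<open>All entries of \<open>R\<close> other than \<open>(k, e)\<close> commute with
  \<open>i\<close>, so both letters \<open>i\<close> can be moved next to \<open>k\<close>.
  Distinctness of the labels excludes a second copy of \<open>(k, e)\<close>, which the set
  difference would hide.\<close>

lemma triple_of_interval:
  assumes L: "X @ (i, a) # R @ (i, d) # Y \<in> \<L>" and k: "(k, e) \<in> set R" "adj i k"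
    and R: "\<forall>v\<in>set R - {(k, e)}. commuting i (fst v)"
  shows "triple {a, e, d}"
proof -
  obtain P Q where PQ: "R = P @ (k, e) # Q"
    using k by (meson split_list)
  have "e \<notin> snd ` (set P \<union> set Q)"
    using distinct_labels[OF L] by (simp add: PQ image_Un)
  then have "(k, e) \<notin> set P \<union> set Q"
    using image_eqI[of e snd "(k, e)"] by auto
  then have "\<forall>y\<in>set P \<union> set Q. commuting i (fst y)"
    using R by (auto simp: PQ)
  moreover have "X @ (i, a) # P @ (k, e) # Q @ (i, d) # Y \<in> \<L>"
    using L by (simp add: PQ)
  ultimately have "X @ P @ (i, a) # (k, e) # (i, d) # Q @ Y \<in> \<L>"
    by (intro gather) auto
  then show ?thesis
    using k(2) tripleI[of "X @ P"] by simp
qed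

text \<open>
  Braiding the triple \<open>k h k\<close> leaves only one neighbour of \<open>i\<close> between the two outer letters \<open>i\<close>,
  and these form a second triple through that neighbour.
\<close>

lemma no_nested_braid:
  assumes L: "X @ (i, b) # R1 @ (k, e1) # R2 @ (k, e3) # R4 @ (i, d) # Y \<in> \<L>"
    and h: "(h, e2) \<in> set R2" "adj k h" "commuting i h" and k: "adj i k"
    and R: "\<forall>v\<in>set R1 \<union> set R2 \<union> set R4. commuting i (fst v)"
    and R2: "\<forall>v\<in>set R2 - {(h, e2)}. commuting k (fst v)"
  shows False
proof -
  obtain P Q where PQ: "R2 = P @ (h, e2) # Q"
    using h by (meson split_list)
  have "e2 \<notin> snd ` (set P \<union> set Q)" and b: "b \<notin> {e1, e2, e3}"
    using distinct_labels[OF L] by (simp_all add: PQ image_Un)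
  then have dist: "(h, e2) \<notin> set P \<union> set Q"
    using image_eqI[of e2 snd "(h, e2)"] by auto
  have L1: "(X @ (i, b) # R1) @ P @ (k, e1) # (h, e2) # (k, e3) # Q @ (R4 @ (i, d) # Y) \<in> \<L>"
    using L R2 dist by (intro gather) (auto simp: PQ)
  then have t: "triple {e1, e2, e3}"
    using h(2) tripleI[of "(X @ (i, b) # R1) @ P"] by simp
  have "(X @ (i, b) # R1 @ P) @ (h, e3) # (k, e2) # (h, e1) # Q @ R4 @ (i, d) # Y \<in> \<L>"
    using L1 h(2) braid[of "X @ (i, b) # R1 @ P" k e1 h e2 e3] by simp
  then have L2: "X @ (i, b) # (R1 @ P @ [(h, e3), (k, e2), (h, e1)] @ Q @ R4) @ (i, d) # Y \<in> \<L>"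
    by simp
  have "triple {b, e2, d}"
    by (rule triple_of_interval[OF L2 _ k]) (use R h(3) in \<open>auto simp: PQ\<close>)
  \<comment> \<open>The braid keeps the label \<open>e2\<close> in the middle but puts it on a
    letter \<open>k\<close>, so both triples contain it.\<close>
  with t have "{b, e2, d} = {e1, e2, e3}"
    using triple_eq[of _ _ e2] by blast
  then show False
    using b by blast
qed

section \<open>Near braids in a fixed word\<close>

context
  fixes L assumes L: "L \<in> \<L>"
begin

abbreviation letter :: "nat \<Rightarrow> 'i" where "letter p \<equiv> fst (L ! p)"
abbreviation label :: "nat \<Rightarrow> 'a" where "label p \<equiv> snd (L ! p)"

text \<open>\<open>commuting\<close> excludes equal letters, so \<open>p\<close> and
  \<open>t\<close> are consecutive occurrences of their letter.\<close>

definition near_braid :: "nat \<Rightarrow> nat \<Rightarrow> nat \<Rightarrow> bool" where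
  "near_braid p q t \<longleftrightarrow> p < q \<and> q < t \<and> t < length L \<and> letter p = letter t \<and> adj (letter p) (letter q) \<and>
     (\<forall>z. p < z \<longrightarrow> z < t \<longrightarrow> z \<noteq> q \<longrightarrow> commuting (letter p) (letter z))"

definition removed :: "nat set" where
  "removed = {t. \<exists>p q. near_braid p q t}"

lemma label_inj: "p < length L \<Longrightarrow> q < length L \<Longrightarrow> label p = label q \<Longrightarrow> p = q"
  using distinct_labels[OF L] by (metis distinct_conv_nth length_map nth_map)

lemma split_two:
  assumes "x < y" "y < length L"
  shows "L = map ((!) L) [0..<x] @ L ! x # map ((!) L) [Suc x..<y] @ L ! y # map ((!) L) [Suc y..<length L]"
proof -
  have "L = map ((!) L) [0..<length L]"
    by (simp add: map_nth)
  also have "[0..<length L] = [0..<x] @ x # [Suc x..<y] @ y # [Suc y..<length L]"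
    using assms upt_split[of 0 x "length L"] upt_split[of "Suc x" y "length L"] by simp
  finally show ?thesis
    by simp
qed

lemma near_braid_triple:
  assumes "near_braid p q t"
  shows "triple {label p, label q, label t}"
proof -
  have p_t: "p < t" "t < length L" "(letter p, label t) = L ! t"
    using assms by (simp_all add: near_braid_def prod_eq_iff)
  have L1: "map ((!) L) [0..<p] @ (letter p, label p) # map ((!) L) [Suc p..<t] @ (letter p, label t) #
      map ((!) L) [Suc t..<length L] \<in> \<L>"
    using L split_two[of p t] p_t by (simp only: prod.collapse)
  have "\<forall>v\<in>set (map ((!) L) [Suc p..<t]) - {(letter q, label q)}. commuting (letter p) (fst v)"
  proof
    fix v assume v: "v \<in> set (map ((!) L) [Suc p..<t]) - {(letter q, label q)}"
    then obtain z where z: "v = L ! z" "p < z" "z < t"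
      by (auto simp: Suc_le_eq)
    moreover have "z \<noteq> q"
      using v z(1) by auto
    ultimately show "commuting (letter p) (fst v)"
      using assms by (metis near_braid_def)
  qed
  then show ?thesis
    using assms by (intro triple_of_interval[OF L1, of "letter q"]) (auto simp: near_braid_def)
qed

text \<open>A shared position is a shared label, so the two triples coincide. Labels determine
  positions, and the order \<open>p < q < t\<close> determines the roles.\<close>

lemma near_braid_unique:
  assumes "near_braid p q t" "near_braid p' q' t'" "{p, q, t} \<inter> {p', q', t'} \<noteq> {}"
  shows "p = p' \<and> q = q' \<and> t = t'"
proof -
  have less: "p < q" "q < t" "t < length L" "p' < q'" "q' < t'" "t' < length L"
    using assms by (auto simp: near_braid_def)
  have "{label p, label q, label t} = {label p', label q', label t'}"
    using assms(3) triple_eq[OF near_braid_triple[OF assms(1)] near_braid_triple[OF assms(2)]] by blast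
  then have "label ` {p, q, t} = label ` {p', q', t'}"
    by simp
  moreover have "inj_on label {..<length L}"
    using label_inj by (auto simp: inj_on_def)
  ultimately have "{p, q, t} = {p', q', t'}"
    using inj_on_image_eq_iff[of label "{..<length L}" "{p, q, t}" "{p', q', t'}"] less by auto
  then have "p \<in> {p', q', t'}" "q \<in> {p', q', t'}" "t \<in> {p', q', t'}"
    "p' \<in> {p, q, t}" "q' \<in> {p, q, t}" "t' \<in> {p, q, t}"
    by blast+
  then show ?thesis
    using less by auto
qed

text \<open>Otherwise the left occurrence could be commuted up to the right one, producing a
  square.\<close>

lemma neighbour_between:
  assumes "x < y" "y < length L" "letter x = letter y" "\<forall>z. x < z \<longrightarrow> z < y \<longrightarrow> letter z \<noteq> letter x"
  obtains z where "x < z" "z < y" "adj (letter x) (letter z)"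
proof (rule ccontr)
  assume "\<not> thesis"
  then have "\<forall>z. x < z \<longrightarrow> z < y \<longrightarrow> commuting (letter x) (letter z)"
    using that assms(4) by (metis commuting_def)
  then have "map ((!) L) [0..<x] @ map ((!) L) [Suc x..<y] @ L ! x # L ! y # map ((!) L) [Suc y..<length L] \<in> \<L>"
    using L split_two[OF assms(1,2)] by (intro shift_right) auto
  then show False
    using assms(3) square_free by (metis append_assoc prod.collapse)
qed

text \<open>By uniqueness a position has a single role, so a left end or a middle is never the right
  end of another near braid.\<close>

lemma near_braid_not_removed:
  assumes "near_braid p q t"
  shows "p \<notin> removed" "q \<notin> removed"
proof -
  have "p < q" "q < t"
    using assms by (auto simp: near_braid_def)
  moreover have "t = t'" if "near_braid p' q' t'" "t' \<in> {p, q}" for p' q' t'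
    using near_braid_unique[OF assms that(1)] that(2) by blast
  ultimately show "p \<notin> removed" "q \<notin> removed"
    by (fastforce simp: removed_def)+
qed

text \<open>If the partner \<open>z0\<close> lies to the left of \<open>x\<close>, then
  \<open>x\<close> is inside the near braid; being joined to the letter at \<open>z\<close>, it
  cannot be one of the commuting letters and must be the middle.\<close>

lemma removed_cases:
  assumes "z \<in> removed" "x < z" "adj (letter x) (letter z)"
  obtains (inside) z0 h where "near_braid z0 h z" "x < z0"
  | (across) z0 where "near_braid z0 x z"
proof -
  obtain z0 h where nb: "near_braid z0 h z"
    using assms(1) by (auto simp: removed_def)
  then have "x \<noteq> z0"
    using assms(3) adj_irrefl by (auto simp: near_braid_def)
  moreover have "h = x" if "z0 < x"
  proof (rule ccontr)
    assume "h \<noteq> x"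
    then have "commuting (letter z) (letter x)"
      using nb that assms(2) by (auto simp: near_braid_def)
    then show False
      using assms(3) adj_sym by (auto simp: commuting_def)
  qed
  ultimately show thesis
    using that nb by fastforce
qed

text \<open>As \<open>r\<close> and \<open>z'\<close> are the only possible neighbours in the gap,
  the letter at the middle \<open>h\<close> commutes with the one at \<open>x\<close>, which makes
  this an instance of \<open>no_nested_braid\<close>.\<close>

lemma no_braid_between:
  assumes xy: "x < y" "y < length L" "letter x = letter y"
    and c: "\<And>z. x < z \<Longrightarrow> z < y \<Longrightarrow> z \<notin> {r, z'} \<Longrightarrow> commuting (letter x) (letter z)"
    and nb: "near_braid r h z'" "x < r" "z' < y" "adj (letter x) (letter r)"
  shows False
proof -
  have order: "r < h" "h < z'" and r: "letter r = letter z'" "adj (letter r) (letter h)"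
    using nb by (auto simp: near_braid_def)
  have split: "[Suc x..<y] = [Suc x..<r] @ r # [Suc r..<z'] @ z' # [Suc z'..<y]"
    using upt_split[of "Suc x" r y] upt_split[of "Suc r" z' y] nb order by simp
  have e: "(letter r, label z') = L ! z'" "(letter x, label y) = L ! y"
    using r(1) xy(3) by (simp_all add: prod_eq_iff)
  have "L = map ((!) L) [0..<x] @ (letter x, label x) # map ((!) L) [Suc x..<r] @ (letter r, label r) #
    map ((!) L) [Suc r..<z'] @ (letter r, label z') # map ((!) L) [Suc z'..<y] @ (letter x, label y) #
    map ((!) L) [Suc y..<length L]"
    using split_two[OF xy(1,2)] by (simp only: split list.map map_append prod.collapse e append.assoc append_Cons)
  then have L1: "map ((!) L) [0..<x] @ (letter x, label x) # map ((!) L) [Suc x..<r] @ (letter r, label r) #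
    map ((!) L) [Suc r..<z'] @ (letter r, label z') # map ((!) L) [Suc z'..<y] @ (letter x, label y) #
    map ((!) L) [Suc y..<length L] \<in> \<L>"
    using L by metis
  have "\<forall>v\<in>set (map ((!) L) [Suc r..<z']) - {(letter h, label h)}. commuting (letter r) (fst v)"
  proof
    fix v assume v: "v \<in> set (map ((!) L) [Suc r..<z']) - {(letter h, label h)}"
    then obtain p where p: "v = L ! p" "r < p" "p < z'"
      by (auto simp: Suc_le_eq)
    moreover have "p \<noteq> h"
      using v p(1) by auto
    ultimately show "commuting (letter r) (fst v)"
      using nb(1) by (metis near_braid_def)
  qed
  then show False
    by (intro no_nested_braid[OF L1, of "letter h" "label h"])
      (use nb r(2) order in \<open>auto intro!: c\<close>)
qed

text \<open>
  Here the left end \<open>x\<close> of the interval is the middle of a triple whose right end \<open>z\<close> lies inside.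
  Braiding that triple replaces \<open>x\<close> by a new left end and removes \<open>z\<close> from the interval.
\<close>

lemma no_braid_across:
  assumes xy: "x < y" "y < length L" "letter x = letter y"
    and across: "near_braid z0 x z" "z < y"
    and r: "x < r" "r < y" "r \<noteq> z" "adj (letter x) (letter r)"
    and c: "\<And>p. x < p \<Longrightarrow> p < y \<Longrightarrow> p \<notin> {z, r} \<Longrightarrow> p \<in> S \<or> commuting (letter x) (letter p)"
    and S: "S = {} \<or> (\<exists>h z'. S = {z'} \<and> near_braid r h z' \<and> z' < y)"
  shows False
proof -
  let ?f = "map ((!) L)"
  let ?i = "letter x" and ?j = "letter z"
  have o: "z0 < x" "x < z" "letter z0 = ?j" "adj ?j ?i"
    using across by (auto simp: near_braid_def)
  \<comment> \<open>Gathering the near braid around \<open>x\<close> takes the letter at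
    \<open>z\<close> out of the gap, so \<open>G\<close> lists positions without
    \<open>z\<close>.\<close>
  define G where "G a b = filter (\<lambda>p. p \<noteq> z) [a..<b]" for a b
  have G_id: "G a b = [a..<b]" if "z < a \<or> b \<le> z" for a b
    using that unfolding G_def by (intro filter_True) auto
  have G_z: "G (Suc x) y = [Suc x..<z] @ [Suc z..<y]"
    using upt_split[of "Suc x" z y] G_id[of "Suc x" z] G_id[of "Suc z" y] o across(2)
    by (simp add: G_def)
  have "L = ?f [0..<z0] @ (?j, label z0) # ?f [Suc z0..<x] @ L ! x # ?f [Suc x..<z] @ (?j, label z) #
      ?f [Suc z..<y] @ L ! y # ?f [Suc y..<length L]"
  proof -
    have "[0..<length L] = [0..<z0] @ z0 # [Suc z0..<x] @ x # [Suc x..<z] @ z # [Suc z..<y] @ y # [Suc y..<length L]"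
      using upt_split[of 0 z0 "length L"] upt_split[of "Suc z0" x "length L"]
        upt_split[of "Suc x" z "length L"] upt_split[of "Suc z" y "length L"] o across(2) xy by simp
    then have "?f [0..<length L] = ?f [0..<z0] @ L ! z0 # ?f [Suc z0..<x] @ L ! x # ?f [Suc x..<z] @ L ! z #
        ?f [Suc z..<y] @ L ! y # ?f [Suc y..<length L]"
      by simp
    moreover have "(?j, label z0) = L ! z0"
      using o(3) by (simp add: prod_eq_iff)
    ultimately show ?thesis
      by (simp only: map_nth prod.collapse)
  qed
  then have "?f [0..<z0] @ (?j, label z0) # ?f [Suc z0..<x] @ L ! x # ?f [Suc x..<z] @ (?j, label z) #
      ?f [Suc z..<y] @ L ! y # ?f [Suc y..<length L] \<in> \<L>"
    using L by metis
  then have "?f [0..<z0] @ ?f [Suc z0..<x] @ (?j, label z0) # L ! x # (?j, label z) # ?f [Suc x..<z] @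
      ?f [Suc z..<y] @ L ! y # ?f [Suc y..<length L] \<in> \<L>"
    using across(1) o by (intro gather) (auto simp: near_braid_def)
  moreover have "(?i, label y) = L ! y"
    using xy(3) by (simp add: prod_eq_iff)
  ultimately have "(?f [0..<z0] @ ?f [Suc z0..<x]) @ (?j, label z0) # (?i, label x) # (?j, label z) # ?f (G (Suc x) y) @
      (?i, label y) # ?f [Suc y..<length L] \<in> \<L>"
    by (simp only: G_z prod.collapse append.assoc map_append append_Cons)
  \<comment> \<open>The rightmost of the three braided letters is again that of \<open>x\<close>,
    but with the label of \<open>z0\<close>; it is the new left end of the gap.\<close>
  from braid[OF this o(4)]
  have L2: "(?f [0..<z0] @ ?f [Suc z0..<x] @ [(?i, label z), (?j, label x)]) @ (?i, label z0) #
      ?f (G (Suc x) y) @ (?i, label y) # ?f [Suc y..<length L] \<in> \<L>"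
    by simp
  show False
    using S
  proof
    assume "S = {}"
    have "\<forall>v\<in>set (?f (G (Suc x) y)) - {(letter r, label r)}. commuting ?i (fst v)"
    proof
      fix v assume v: "v \<in> set (?f (G (Suc x) y)) - {(letter r, label r)}"
      then obtain p where p: "v = L ! p" "x < p" "p < y" "p \<noteq> z"
        by (auto simp: Suc_le_eq G_def)
      moreover have "p \<noteq> r"
        using v p(1) by auto
      ultimately show "commuting ?i (fst v)"
        using c \<open>S = {}\<close> by auto
    qed
    moreover have "r \<in> set (G (Suc x) y)"
      using r by (simp add: G_def)
    \<comment> \<open>This triple shares \<open>label z0\<close> with the near braid around
      \<open>x\<close>, although \<open>y\<close> lies to the right of all positions of the
      latter.\<close>
    ultimately have "triple {label z0, label r, label y}"
      using r(4) by (intro triple_of_interval[OF L2, of "letter r"]) auto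
    with near_braid_triple[OF across(1)]
    have "{label z0, label x, label z} = {label z0, label r, label y}"
      using triple_eq by blast
    then have "label y \<in> {label z0, label x, label z}"
      by blast
    moreover have "label p \<noteq> label y" if "p < y" for p
      using label_inj[of p y] that xy(2) by auto
    then have "label z0 \<noteq> label y" "label x \<noteq> label y" "label z \<noteq> label y"
      using o xy(1) across(2) by simp_all
    ultimately show False
      by simp
  next
    assume "\<exists>h z'. S = {z'} \<and> near_braid r h z' \<and> z' < y"
    then obtain h z' where S: "S = {z'}" and nb: "near_braid r h z'" "z' < y"
      by blast
    have ord: "r < h" "h < z'" "letter r = letter z'" "adj (letter r) (letter h)"
      using nb by (auto simp: near_braid_def)
    have "z' \<noteq> z" "h \<noteq> z"
      using near_braid_unique[OF nb(1) across(1)] o r by auto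
    then have G_r: "G (Suc x) y = G (Suc x) r @ r # G (Suc r) z' @ z' # G (Suc z') y"
      using upt_split[of "Suc x" r y] upt_split[of "Suc r" z' y] ord nb r by (simp add: G_def)
    have r_z': "(letter r, label z') = L ! z'"
      using ord(3) by (simp add: prod_eq_iff)
    have L3: "(?f [0..<z0] @ ?f [Suc z0..<x] @ [(?i, label z), (?j, label x)]) @ (?i, label z0) #
      ?f (G (Suc x) r) @ (letter r, label r) # ?f (G (Suc r) z') @ (letter r, label z') # ?f (G (Suc z') y) @
      (?i, label y) # ?f [Suc y..<length L] \<in> \<L>"
      using L2 by (simp only: G_r r_z' list.map map_append prod.collapse append.assoc append_Cons)
    have cc: "commuting ?i (letter p)" if "x < p" "p < y" "p \<noteq> z" "p \<noteq> r" "p \<noteq> z'" for p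
      using c[of p] that S by auto
    have "\<forall>v\<in>set (?f (G (Suc r) z')) - {(letter h, label h)}. commuting (letter r) (fst v)"
    proof
      fix v assume v: "v \<in> set (?f (G (Suc r) z')) - {(letter h, label h)}"
      then obtain p where p: "v = L ! p" "r < p" "p < z'"
        by (auto simp: Suc_le_eq G_def)
      moreover have "p \<noteq> h"
        using v p(1) by auto
      ultimately show "commuting (letter r) (fst v)"
        using nb(1) by (metis near_braid_def)
    qed
    then show False
      by (intro no_nested_braid[OF L3, of "letter h" "label h"])
        (use ord nb r cc \<open>h \<noteq> z\<close> in \<open>auto simp: G_def\<close>)
  qed
qed

text \<open>If the letter recurs inside the gap, its first recurrence closes a near braid that
  starts at \<open>x\<close> and has \<open>r\<close> as its middle, which leaves no kept neighbour
  for the stretch up to the next occurrence. If it does not recur, there are at least two neighbours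
  in the gap, all deleted except possibly \<open>r\<close>; according to whether one of them belongs
  to a near braid with middle \<open>x\<close>, this contradicts \<open>no_braid_across\<close> or
  \<open>no_braid_between\<close>.\<close>

lemma no_sparse_interval:
  assumes xy: "x < y" "y < length L" "letter x = letter y" "x \<notin> removed" "y \<notin> removed"
    and no_i: "\<And>z. x < z \<Longrightarrow> z < y \<Longrightarrow> letter z = letter x \<Longrightarrow> z \<in> removed"
    and r: "\<And>z. x < z \<Longrightarrow> z < y \<Longrightarrow> adj (letter x) (letter z) \<Longrightarrow> z \<notin> removed \<Longrightarrow> z = r"
  shows False
proof (cases "\<exists>z. x < z \<and> z < y \<and> letter z = letter x")
  case True
  define y1 where "y1 = (LEAST z. x < z \<and> letter z = letter x)"
  have y1: "x < y1" "letter y1 = letter x" and y1_min: "\<And>z. x < z \<Longrightarrow> letter z = letter x \<Longrightarrow> y1 \<le> z"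
    using LeastI_ex[of "\<lambda>z. x < z \<and> letter z = letter x"] True
      Least_le[of "\<lambda>z. x < z \<and> letter z = letter x"] unfolding y1_def by blast+
  have "y1 < y"
    using True y1_min by fastforce
  then obtain x' q where nb': "near_braid x' q y1"
    using no_i[OF y1(1) _ y1(2)] by (auto simp: removed_def)
  have "\<not> x' < x"
  proof
    assume "x' < x"
    then have "x = q \<or> commuting (letter x') (letter x)"
      using nb' y1(1) by (auto simp: near_braid_def)
    then show False
      using nb' y1(2) adj_irrefl by (auto simp: near_braid_def commuting_def)
  qed
  then have "x' = x"
    using nb' y1 y1_min[of x'] by (fastforce simp: near_braid_def)
  with nb' have nb: "near_braid x q y1"
    by simp
  define y2 where "y2 = (LEAST z. y1 < z \<and> letter z = letter x)"
  have y2: "y1 < y2" "letter y2 = letter x" "y2 \<le> y"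
    and y2_min: "\<And>z. y1 < z \<Longrightarrow> letter z = letter x \<Longrightarrow> y2 \<le> z"
    using LeastI[of "\<lambda>z. y1 < z \<and> letter z = letter x" y] \<open>y1 < y\<close> xy(3)
      Least_le[of "\<lambda>z. y1 < z \<and> letter z = letter x"] unfolding y2_def by auto
  have "\<forall>z. y1 < z \<longrightarrow> z < y2 \<longrightarrow> letter z \<noteq> letter y1"
    using y2_min y1(2) by (metis leD)
  then obtain z where z: "y1 < z" "z < y2" "adj (letter y1) (letter z)"
    using neighbour_between[of y1 y2] y2 y1(2) xy(2) by auto
  have "q = r"
    using r[of q] nb near_braid_not_removed[OF nb] \<open>y1 < y\<close> by (auto simp: near_braid_def)
  then have "r < y1"
    using nb by (simp add: near_braid_def)
  show False
  proof (cases "z \<in> removed")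
    case False
    then show False
      using r[of z] z y1 y2 \<open>r < y1\<close> by auto
  next
    \<comment> \<open>The left end of the near braid that deletes \<open>z\<close> would have to be
      \<open>r\<close>, which lies before \<open>y1\<close>, or else \<open>y1\<close> would be the
      middle of one near braid and the right end of another.\<close>
    case True
    then show False
      using z(1,3)
    proof (cases rule: removed_cases)
      case (inside z0 h)
      then have "z0 = r"
        using near_braid_not_removed[OF inside(1)] r[of z0] z y1 y2 by (auto simp: near_braid_def)
      then show False
        using inside \<open>r < y1\<close> by simp
    next
      case (across z0)
      then show False
        using near_braid_unique[OF nb across] nb by (auto simp: near_braid_def)
    qed
  qed
next
  case False
  define S where "S = {z. x < z \<and> z < y \<and> adj (letter x) (letter z)}"
  have comm: "commuting (letter x) (letter z)" if "x < z" "z < y" "z \<notin> S" for z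
    using that False unfolding S_def commuting_def by auto
  \<comment> \<open>There are at least two neighbours: one alone would make \<open>y\<close> the
    right end of a near braid, hence deleted.\<close>
  have single: "\<exists>w\<in>S. w \<noteq> z" for z
  proof (rule ccontr)
    assume *: "\<not> (\<exists>w\<in>S. w \<noteq> z)"
    obtain w where "w \<in> S"
      using neighbour_between[OF xy(1-3)] False unfolding S_def by blast
    have "w = z" if "w \<in> S" for w
      using * that by metis
    with \<open>w \<in> S\<close> have "S = {z}"
      by auto
    then have "z \<in> S" "\<And>p. x < p \<Longrightarrow> p < y \<Longrightarrow> p \<noteq> z \<Longrightarrow> commuting (letter x) (letter p)"
      using comm by simp_all
    then have "near_braid x z y"
      using xy(2,3) by (simp add: near_braid_def S_def)
    then show False
      using xy(5) by (auto simp: removed_def)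
  qed
  have keep: "z = r" if "z \<in> S" "z \<notin> removed" for z
    using r that by (auto simp: S_def)
  have companion: "\<exists>h. near_braid r h z \<and> r \<in> S" if "near_braid z0 h z" "x < z0" "z \<in> S" for z z0 h
  proof -
    have "z0 \<in> S"
      using that by (auto simp: S_def near_braid_def)
    then show ?thesis
      using keep near_braid_not_removed[OF that(1)] that(1) by blast
  qed
  show False
  proof (cases "\<exists>z z0. z \<in> S \<and> near_braid z0 x z")
    case True
    then obtain z z0 where z: "z \<in> S" "near_braid z0 x z"
      by blast
    have other: "w = r \<or> (\<exists>h. near_braid r h w)" and r_S: "r \<in> S" if "w \<in> S" "w \<noteq> z" for w
    proof -
      have "w = r \<and> r \<in> S \<or> (\<exists>h. near_braid r h w \<and> r \<in> S)"
      proof (cases "w \<in> removed")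
        case True
        then have "x < w" "adj (letter x) (letter w)"
          using that by (auto simp: S_def)
        with True show ?thesis
        proof (cases rule: removed_cases)
          case (inside w0 h)
          then show ?thesis
            using companion[OF inside] that by blast
        next
          case (across w0)
          then show ?thesis
            using near_braid_unique[OF across z(2)] that by blast
        qed
      qed (use keep that in blast)
      then show "w = r \<or> (\<exists>h. near_braid r h w)" "r \<in> S"
        by blast+
    qed
    have "r \<in> S"
      using single[of z] r_S by blast
    have "r \<noteq> z"
    proof
      assume "r = z"
      obtain w where w: "w \<in> S" "w \<noteq> z"
        using single by blast
      then obtain h where "near_braid z h w"
        using other[OF w] \<open>r = z\<close> by blast
      then show False
        using near_braid_unique[OF _ z(2), of z h w] w(2) by blast
    qed
    define S' where "S' = S - {z, r}"
    \<comment> \<open>By uniqueness \<open>r\<close> is the left end of at most one near braid, so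
      at most one neighbour remains besides \<open>z\<close> and \<open>r\<close>.\<close>
    have sub: "S' = {} \<or> (\<exists>h z'. S' = {z'} \<and> near_braid r h z' \<and> z' < y)"
    proof (cases "S' = {}")
      case False
      then obtain z' where z': "z' \<in> S'"
        by blast
      then obtain h where h: "near_braid r h z'"
        using other[of z'] by (auto simp: S'_def)
      have "w = z'" if w: "w \<in> S'" for w
      proof -
        obtain h' where "near_braid r h' w"
          using other[of w] w unfolding S'_def by blast
        then show ?thesis
          using near_braid_unique[OF h] by blast
      qed
      then have "S' = {z'}"
        using z' by blast
      then show ?thesis
        using h z' by (auto simp: S'_def S_def)
    qed simp
    show False
    proof (rule no_braid_across[OF xy(1-3) z(2) _ _ _ _ _ _ sub])
      show "z < y" "x < r" "r < y" "r \<noteq> z" "adj (letter x) (letter r)"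
        using z(1) \<open>r \<in> S\<close> \<open>r \<noteq> z\<close> by (simp_all add: S_def)
      show "p \<in> S' \<or> commuting (letter x) (letter p)" if "x < p" "p < y" "p \<notin> {z, r}" for p
        using comm[OF that(1,2)] that(3) by (auto simp: S'_def)
    qed
  next
    case no_across: False
    have other: "w = r \<or> (\<exists>h. near_braid r h w)" and r_S: "r \<in> S" if "w \<in> S" for w
    proof -
      have "w = r \<and> r \<in> S \<or> (\<exists>h. near_braid r h w \<and> r \<in> S)"
      proof (cases "w \<in> removed")
        case True
        then have "x < w" "adj (letter x) (letter w)"
          using that by (auto simp: S_def)
        with True show ?thesis
        proof (cases rule: removed_cases)
          case (inside w0 h)
          then show ?thesis
            using companion[OF inside] that by blast
        next
          case (across w0)
          then show ?thesis
            using no_across that by blast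
        qed
      qed (use keep that in blast)
      then show "w = r \<or> (\<exists>h. near_braid r h w)" "r \<in> S"
        by blast+
    qed
    obtain z' where z': "z' \<in> S" "z' \<noteq> r"
      using single by blast
    then obtain h where h: "near_braid r h z'"
      using other by blast
    have "S \<subseteq> {r, z'}"
    proof
      fix w assume "w \<in> S"
      then show "w \<in> {r, z'}"
        using other[of w] near_braid_unique[OF h, of r _ w] by blast
    qed
    show False
    proof (rule no_braid_between[OF xy(1-3) _ h])
      show "x < r" "z' < y" "adj (letter x) (letter r)"
        using z'(1) r_S[OF z'(1)] by (simp_all add: S_def)
      show "commuting (letter x) (letter p)" if "x < p" "p < y" "p \<notin> {r, z'}" for p
        using comm[OF that(1,2)] that(3) \<open>S \<subseteq> {r, z'}\<close> by blast
    qed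
  qed
qed

text \<open>Sending each right end to its left end injects the deleted positions into the kept
  ones.\<close>

lemma card_removed: "2 * card removed \<le> length L"
proof -
  have "\<exists>p q. near_braid p q t" if "t \<in> removed" for t
    using that by (simp add: removed_def)
  then obtain P Q where nb: "\<And>t. t \<in> removed \<Longrightarrow> near_braid (P t) (Q t) t"
    by metis
  have sub: "removed \<subseteq> {..<length L}"
    by (auto simp: removed_def near_braid_def)
  have "inj_on P removed"
  proof (rule inj_onI)
    fix t t' assume t: "t \<in> removed" "t' \<in> removed" "P t = P t'"
    then show "t = t'"
      using near_braid_unique[OF nb[OF t(1)] nb[OF t(2)]] by blast
  qed
  moreover have "P ` removed \<subseteq> {..<length L} - removed"
  proof
    fix p assume "p \<in> P ` removed"
    then obtain t where t: "p = P t" "t \<in> removed"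
      by blast
    then show "p \<in> {..<length L} - removed"
      using nb[OF t(2)] near_braid_not_removed[OF nb[OF t(2)]] by (simp add: near_braid_def)
  qed
  ultimately have "card removed \<le> card ({..<length L} - removed)"
    by (intro card_inj_on_le) auto
  also have "\<dots> = length L - card removed"
    using sub by (simp add: card_Diff_subset finite_subset)
  finally show ?thesis
    using card_mono[OF _ sub] by simp
qed

lemma well_spaced_thinning:
  "\<exists>u. well_spaced adj u \<and> set u \<subseteq> fst ` set L \<and> length L \<le> 2 * length u"
proof -
  define ps where "ps = filter (\<lambda>p. p \<notin> removed) [0..<length L]"
  have pattern: "pattern adj i (map letter ps) = map (\<lambda>p. letter p = i)
      (filter (\<lambda>p. p \<notin> removed \<and> (letter p = i \<or> adj i (letter p))) [0..<length L])" for i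
    by (simp add: pattern_def ps_def filter_map o_def conj_commute)
  have "well_spaced adj (map letter ps)"
    unfolding well_spaced_def
  proof (intro allI conjI notI)
    fix i a c
    let ?P = "\<lambda>p. p \<notin> removed \<and> (letter p = i \<or> adj i (letter p))"
    assume "pattern adj i (map letter ps) = a @ [True, True] @ c"
    then obtain us x y vs where f: "filter ?P [0..<length L] = us @ x # y # vs"
        and l: "letter x = i" "letter y = i"
      unfolding pattern by (auto simp: map_eq_append_conv map_eq_Cons_conv)
    have xy: "x < y" "y < length L" "?P x" "?P y" "\<And>z. x < z \<Longrightarrow> z < y \<Longrightarrow> \<not> ?P z"
      using filter_upt_consecutive[OF f] by blast+
    \<comment> \<open>No neighbour is kept between \<open>x\<close> and \<open>y\<close>, so the
      condition on \<open>r\<close> is vacuous and \<open>x\<close> can serve as its value.\<close>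
    show False
      by (rule no_sparse_interval[of x y x]) (use xy l in auto)
  next
    fix i a c
    let ?P = "\<lambda>p. p \<notin> removed \<and> (letter p = i \<or> adj i (letter p))"
    assume "pattern adj i (map letter ps) = a @ [True, False, True] @ c"
    then obtain us x r y vs where f: "filter ?P [0..<length L] = us @ x # r # y # vs"
        and l: "letter x = i" "letter y = i" "letter r \<noteq> i"
      unfolding pattern by (auto simp: map_eq_append_conv map_eq_Cons_conv)
    have 1: "x < r" "?P x" "?P r" "\<And>z. x < z \<Longrightarrow> z < r \<Longrightarrow> \<not> ?P z"
      using filter_upt_consecutive[OF f] by blast+
    have 2: "r < y" "y < length L" "?P y" "\<And>z. r < z \<Longrightarrow> z < y \<Longrightarrow> \<not> ?P z"
      using filter_upt_consecutive[of ?P "length L" "us @ [x]" r y vs] f by auto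
    have only_r: "z = r" if "x < z" "z < y" "?P z" for z
      using 1(4)[of z] 2(4)[of z] that by linarith
    show False
    proof (rule no_sparse_interval[of x y r])
      show "x < y" "y < length L" "letter x = letter y" "x \<notin> removed" "y \<notin> removed"
        using 1(1,2) 2(1-3) l by simp_all
      show "z \<in> removed" if "x < z" "z < y" "letter z = letter x" for z
        using only_r[OF that(1,2)] that(3) l by blast
      show "z = r" if "x < z" "z < y" "adj (letter x) (letter z)" "z \<notin> removed" for z
        using only_r[OF that(1,2)] that(3,4) l(1) by blast
    qed
  qed
  moreover have "length L \<le> 2 * length (map letter ps)"
  proof -
    have "removed \<subseteq> {..<length L}"
      by (auto simp: removed_def near_braid_def)
    moreover have "length ps = card ({..<length L} - removed)"
      unfolding ps_def by (subst distinct_card[symmetric]) (auto intro!: arg_cong[where f = card])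
    ultimately have "length ps = length L - card removed"
      by (simp add: card_Diff_subset finite_subset)
    then show ?thesis
      using card_removed by simp
  qed
  moreover have "set (map letter ps) \<subseteq> fst ` set L"
    by (auto simp: ps_def)
  ultimately show ?thesis
    by blast
qed

end

end

section \<open>Words, roots and Matsumoto's theorem\<close>

lemma word_action_append: "word_action m (u @ v) x = word_action m u (word_action m v x)"
  by (simp add: word_action_def)

lemma word_action_Nil [simp]: "word_action m [] x = x"
  by (simp add: word_action_def)

lemma word_action_Cons: "word_action m (i # u) x = simple_reflection m i (word_action m u x)"
  by (simp add: word_action_def)

lemma simple_reflection_diff:
  "simple_reflection m i (x - y) = simple_reflection m i x - simple_reflection m i y"
  by (simp add: simple_reflection_def coxeter_form_diff right_diff_distrib single_diff)

lemma word_action_diff: "word_action m u (x - y) = word_action m u x - word_action m u y"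
  by (induction u) (simp_all add: word_action_Cons simple_reflection_diff)

lemma word_action_zero: "word_action m u 0 = 0"
  using word_action_diff[of m u 0 0] by simp

lemma word_action_uminus: "word_action m u (- x) = - word_action m u x"
  using word_action_diff[of m u 0 x] by (simp add: word_action_zero)

lemma word_action_add: "word_action m u (x + y) = word_action m u x + word_action m u y"
  using word_action_diff[of m u x "- y"] by (simp add: word_action_uminus)

lemma lookup_simple_reflection:
  "k \<noteq> i \<Longrightarrow> Poly_Mapping.lookup (simple_reflection m i x) k = Poly_Mapping.lookup x k"
  by (simp add: simple_reflection_def lookup_minus lookup_single)

lemma lookup_simple_root: "Poly_Mapping.lookup (simple_root i) k = (if k = i then 1 else 0)"
  by (auto simp: simple_root_def lookup_single when_def)

lemma coxeter_form_simple_roots: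
  "coxeter_form m (simple_root j) (simple_root i) = - cos (pi / real (m j i))"
  using coxeter_form_single[of m j 1 i] by (simp add: simple_root_def)

lemma simple_reflection_simple_root:
  "m i i = 1 \<Longrightarrow> simple_reflection m i (simple_root i) = - simple_root i"
  "m j i = 2 \<Longrightarrow> simple_reflection m i (simple_root j) = simple_root j"
  "m j i = 3 \<Longrightarrow> simple_reflection m i (simple_root j) = simple_root j + simple_root i"
  by (auto intro!: poly_mapping_eqI simp: simple_reflection_def coxeter_form_simple_roots
      lookup_minus lookup_add lookup_single lookup_simple_root when_def cos_60)

text \<open>
  Each letter of a word is labelled with its entry in the root sequence, which depends only on the
  letters to its right. Commutations move the labels along with the letters.
\<close>

fun labelled :: "('i \<Rightarrow> 'i \<Rightarrow> nat) \<Rightarrow> 'i list \<Rightarrow> ('i \<times> ('i \<Rightarrow>\<^sub>0 real)) list" where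
  "labelled m [] = []"
| "labelled m (i # u) = (i, word_action m (rev u) (simple_root i)) # labelled m u"

lemma map_fst_labelled [simp]: "map fst (labelled m u) = u"
  by (induction u) simp_all

lemma length_labelled [simp]: "length (labelled m u) = length u"
  by (metis length_map map_fst_labelled)

lemma labelled_append:
  "labelled m (u @ v) = map (apsnd (word_action m (rev v))) (labelled m u) @ labelled m v"
  by (induction u) (simp_all add: word_action_append)

lemma labelled_eq_append:
  assumes "labelled m u = A @ E"
  shows "E = labelled m (map fst E)" "u = map fst A @ map fst E"
proof -
  show u: "u = map fst A @ map fst E"
    using arg_cong[OF assms, of "map fst"] by simp
  have "map (apsnd (word_action m (rev (map fst E)))) (labelled m (map fst A)) @ labelled m (map fst E) = A @ E"
    using assms labelled_append[of m "map fst A" "map fst E"] u by simp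
  then show "E = labelled m (map fst E)"
    by (simp add: append_eq_append_conv)
qed

lemma root_sequence_eq: "root_sequence m u = rev (map snd (labelled m u))"
proof (induction u)
  case (Cons i u)
  have "root_sequence m (i # u) = root_sequence m u @ [word_action m (rev u) (simple_root i)]"
    unfolding root_sequence_def by (auto simp: nth_append)
  then show ?case
    using Cons by simp
qed (simp add: root_sequence_def)

section \<open>Words and relations in a simply laced group\<close>

locale simply_laced_system = coxeter_system G I m s
  for G :: "('g, 'b) monoid_scheme" (structure) and I :: "'i set" and m s +
  assumes simply_laced: "simply_laced I m"
begin

abbreviation wp :: "'i list \<Rightarrow> 'g" where "wp \<equiv> word_prod G s"
abbreviation act :: "'i list \<Rightarrow> ('i \<Rightarrow>\<^sub>0 real) \<Rightarrow> ('i \<Rightarrow>\<^sub>0 real)" where "act \<equiv> word_action m"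

text \<open>Membership in \<open>I\<close> is built in because \<open>m\<close> is constrained only
  there; this makes the relation symmetric and irreflexive on the whole type.\<close>

definition bond :: "'i \<Rightarrow> 'i \<Rightarrow> bool" where
  "bond i j \<longleftrightarrow> i \<in> I \<and> j \<in> I \<and> m i j = 3"

lemma bond_sym: "bond i j \<Longrightarrow> bond j i"
  using m_sym by (auto simp: bond_def)

lemma m_cases:
  assumes "i \<in> I" "j \<in> I" "i \<noteq> j"
  obtains "m i j = 2" "m j i = 2" | "m i j = 3" "m j i = 3"
proof -
  have "m i j = 2 \<or> m i j = 3"
    using simply_laced assms by (simp add: simply_laced_def)
  then show thesis
    using that m_sym[OF assms(1,2)] by metis
qed

lemma s_closed [simp]: "i \<in> I \<Longrightarrow> s i \<in> carrier G"
  using gen_closed by blast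

lemma wp_Nil [simp]: "wp [] = \<one>"
  by (simp add: word_prod_def)

lemma wp_Cons [simp]: "wp (i # u) = s i \<otimes> wp u"
  by (simp add: word_prod_def)

lemma wp_closed [simp]: "u \<in> lists I \<Longrightarrow> wp u \<in> carrier G"
  by (induction u) auto

lemma wp_append: "u \<in> lists I \<Longrightarrow> v \<in> lists I \<Longrightarrow> wp (u @ v) = wp u \<otimes> wp v"
  by (induction u) (auto simp: m_assoc)

lemma rev_lists: "u \<in> lists I \<Longrightarrow> rev u \<in> lists I"
  by (induction u) auto

lemma wp_context:
  assumes "x \<in> lists I" "y \<in> lists I" "u \<in> lists I" "v \<in> lists I" "wp u = wp v"
  shows "wp (x @ u @ y) = wp (x @ v @ y)"
  using assms by (simp add: wp_append del: in_lists_conv_set)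

lemma relation: "i \<in> I \<Longrightarrow> j \<in> I \<Longrightarrow> wp (concat (replicate (m i j) [i, j])) = \<one>"
proof -
  assume ij: "i \<in> I" "j \<in> I"
  have "coxeter_equiv I m ([] @ concat (replicate (m i j) [i, j]) @ []) ([] @ [])"
    using ij by (intro coxeter_equiv.relator) auto
  moreover have "concat (replicate (m i j) [i, j]) \<in> lists I"
    using ij by (auto simp: set_replicate_conv_if split: if_splits)
  ultimately show ?thesis
    using presented[of "concat (replicate (m i j) [i, j])" "[]"] by simp
qed

lemma s_square: "i \<in> I \<Longrightarrow> s i \<otimes> s i = \<one>"
  using relation[of i i] m_diag[of i] by simp

lemma wp_square: "i \<in> I \<Longrightarrow> wp [i, i] = wp []"
  by (simp add: s_square)

lemma s_inv: "i \<in> I \<Longrightarrow> inv (s i) = s i"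
  by (simp add: s_square inv_equality)

lemma wp_rev: "u \<in> lists I \<Longrightarrow> wp (rev u) = inv (wp u)"
proof (induction u)
  case (Cons i u)
  then have "i \<in> I" "u \<in> lists I"
    by auto
  with Cons.IH show ?case
    using wp_append[of "rev u" "[i]"] rev_lists[of u] by (simp add: inv_mult_group s_inv del: in_lists_conv_set)
qed simp

text \<open>Generators are involutions, so reversal inverts a word. This turns a relator into the
  commutation or braid relation.\<close>

lemma wp_eq_rev: "u \<in> lists I \<Longrightarrow> v \<in> lists I \<Longrightarrow> wp (u @ v) = \<one> \<Longrightarrow> wp u = wp (rev v)"
  by (simp add: wp_rev wp_append inv_equality[symmetric] del: in_lists_conv_set)

lemma wp_commute: "i \<in> I \<Longrightarrow> j \<in> I \<Longrightarrow> m i j = 2 \<Longrightarrow> wp [i, j] = wp [j, i]"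
  using wp_eq_rev[of "[i, j]" "[i, j]"] relation[of i j] by (simp add: numeral_2_eq_2)

lemma wp_braid: "i \<in> I \<Longrightarrow> j \<in> I \<Longrightarrow> m i j = 3 \<Longrightarrow> wp [i, j, i] = wp [j, i, j]"
  using wp_eq_rev[of "[i, j, i]" "[j, i, j]"] relation[of i j] by (simp add: numeral_3_eq_3)

lemma wp_cancel_right:
  assumes "u \<in> lists I" "v \<in> lists I" "i \<in> I" "wp (u @ [i]) = wp (v @ [i])"
  shows "wp u = wp v"
  using assms by (simp add: wp_append del: in_lists_conv_set)

lemma wp_snoc_snoc: "u \<in> lists I \<Longrightarrow> i \<in> I \<Longrightarrow> wp (u @ [i, i]) = wp u"
  using wp_context[of u "[]" "[i, i]" "[]"] wp_square by simp

lemma act_cong: "u \<in> lists I \<Longrightarrow> v \<in> lists I \<Longrightarrow> wp u = wp v \<Longrightarrow> act u = act v"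
  using action_word_prod[OF simply_laced] by metis

lemma act_rev:
  assumes "u \<in> lists I"
  shows "act (rev u) (act u x) = x" "act u (act (rev u) x) = x"
proof -
  have "wp (rev u @ u) = wp []" "wp (u @ rev u) = wp []"
    using wp_append[OF rev_lists[OF assms] assms] wp_append[OF assms rev_lists[OF assms]]
      wp_rev[OF assms] wp_closed[OF assms] by simp_all
  then have "act (rev u @ u) = act []" "act (u @ rev u) = act []"
    using assms rev_lists[OF assms] by (simp_all only: act_cong append_in_lists_conv lists.Nil)
  then show "act (rev u) (act u x) = x" "act u (act (rev u) x) = x"
    by (simp_all flip: word_action_append)
qed

lemma act_inj: "u \<in> lists I \<Longrightarrow> act u x = act u y \<Longrightarrow> x = y"
  using act_rev(1) by metis

lemma coxeter_equiv_parity: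
  "coxeter_equiv I m u v \<Longrightarrow> even (length u) = even (length v)"
proof (induction rule: coxeter_equiv.induct)
  case (relator u v i j)
  have "length (concat (replicate n [i, j])) = 2 * n" for n
    by (induction n) auto
  then show ?case
    by simp
qed auto

text \<open>Relators have even length. In \<open>descent\<close> this rules out that multiplication
  by a generator preserves the length.\<close>

lemma length_parity:
  assumes "u \<in> lists I" "v \<in> lists I" "wp u = wp v"
  shows "even (length u) = even (length v)"
proof -
  show ?thesis
    using presented[OF assms(1,2)] assms(3) coxeter_equiv_parity by blast
qed

section \<open>Reduced words and descents\<close>

lemma reduced_lists: "reduced u \<Longrightarrow> u \<in> lists I"
  by (simp add: reduced_def)

lemma reduced_transfer:
  "reduced u \<Longrightarrow> v \<in> lists I \<Longrightarrow> wp v = wp u \<Longrightarrow> length v \<le> length u \<Longrightarrow> reduced v"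
  unfolding reduced_def by (metis order_trans)

lemma reduced_length: "reduced u \<Longrightarrow> reduced v \<Longrightarrow> wp u = wp v \<Longrightarrow> length u = length v"
  unfolding reduced_def by (metis order_antisym)

lemma reduced_infix:
  assumes "reduced (x @ u @ y)"
  shows "reduced u"
  unfolding reduced_def
proof (intro conjI ballI impI)
  have l: "x \<in> lists I" "u \<in> lists I" "y \<in> lists I"
    using reduced_lists[OF assms] by auto
  then show "u \<in> lists I"
    by blast
  fix v assume v: "v \<in> lists I" "wp v = wp u"
  have "wp (x @ v @ y) = wp (x @ u @ y)"
    using wp_context l v by blast
  moreover have "x @ v @ y \<in> lists I"
    using l v by simp
  ultimately have "length (x @ u @ y) \<le> length (x @ v @ y)"
    using assms unfolding reduced_def by blast
  then show "length u \<le> length v"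
    by simp
qed

lemma reduced_rev:
  assumes "reduced u"
  shows "reduced (rev u)"
  unfolding reduced_def
proof (intro conjI ballI impI)
  have u: "u \<in> lists I"
    using reduced_lists[OF assms] .
  then show "rev u \<in> lists I"
    by (rule rev_lists)
  fix v assume v: "v \<in> lists I" "wp v = wp (rev u)"
  have "wp (rev v) = wp u"
    using u v by (simp add: wp_rev del: in_lists_conv_set)
  moreover have "rev v \<in> lists I"
    using v(1) by (rule rev_lists)
  ultimately have "length u \<le> length (rev v)"
    using assms unfolding reduced_def by blast
  then show "length (rev u) \<le> length v"
    by simp
qed

lemma exists_reduced:
  assumes "u \<in> lists I"
  obtains v where "reduced v" "wp v = wp u"
proof -
  let ?P = "\<lambda>v. v \<in> lists I \<and> wp v = wp u"
  obtain v where "?P v" "\<forall>v'. ?P v' \<longrightarrow> length v \<le> length v'"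
    using ex_has_least_nat[of ?P u length] assms by blast
  then show thesis
    using that[of v] by (simp add: reduced_def del: in_lists_conv_set)
qed

lemma reduced_no_square: "\<not> reduced (x @ [i, i] @ y)"
proof
  assume r: "reduced (x @ [i, i] @ y)"
  then have l: "x \<in> lists I" "y \<in> lists I" "i \<in> I"
    using reduced_lists[OF r] by auto
  then have "wp (x @ [] @ y) = wp (x @ [i, i] @ y)"
    using wp_context[of x y "[]" "[i, i]"] wp_square[of i] by simp
  then have "length (x @ [i, i] @ y) \<le> length (x @ y)"
    using r l unfolding reduced_def by (metis append_Nil append_in_lists_conv)
  then show False
    by simp
qed

text \<open>A shortest word \<open>v\<close> for \<open>wp (u @ [i])\<close> is shorter than
  \<open>u @ [i]\<close> and, by parity, not as long as \<open>u\<close>; hence appending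
  \<open>i\<close> to it gives a reduced word for \<open>wp u\<close>. This takes the place of the
  exchange condition.\<close>

lemma descent:
  assumes u: "reduced u" and i: "i \<in> I" and n: "\<not> reduced (u @ [i])"
  obtains v where "reduced (v @ [i])" "wp (v @ [i]) = wp u"
proof -
  have l: "u \<in> lists I" "u @ [i] \<in> lists I"
    using reduced_lists[OF u] i by auto
  obtain v where v: "reduced v" "wp v = wp (u @ [i])"
    using exists_reduced[OF l(2)] .
  have vl: "v \<in> lists I" "v @ [i] \<in> lists I"
    using reduced_lists[OF v(1)] i by auto
  have "wp (v @ [i]) = wp ((u @ [i]) @ [i])"
    using wp_append[of v "[i]"] wp_append[of "u @ [i]" "[i]"] vl(1) l v(2) i by simp
  then have eq: "wp (v @ [i]) = wp u"
    using wp_snoc_snoc[OF l(1) i] by simp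
  have "length v \<noteq> length u"
    using length_parity[OF vl(1) l(2) v(2)] by auto
  moreover have "\<not> length (u @ [i]) \<le> length v"
    using n reduced_transfer[OF v(1) l(2)] v(2) by auto
  ultimately have "length (v @ [i]) \<le> length u"
    by simp
  then have "reduced (v @ [i])"
    using reduced_transfer[OF u vl(2) eq] by simp
  then show thesis
    using that eq by blast
qed

section \<open>Descents and the signs of roots\<close>

definition nonneg :: "('i \<Rightarrow>\<^sub>0 real) \<Rightarrow> bool" where
  "nonneg x \<longleftrightarrow> (\<forall>k. 0 \<le> Poly_Mapping.lookup x k)"

lemma act_snoc:
  "act (u @ [i]) x = act u (simple_reflection m i x)"
  by (simp add: word_action_append word_action_Cons)

lemma act_snoc_root:
  shows "i \<in> I \<Longrightarrow> act (u @ [i]) (simple_root i) = - act u (simple_root i)"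
    and "m j i = 2 \<Longrightarrow> act (u @ [i]) (simple_root j) = act u (simple_root j)"
    and "m j i = 3 \<Longrightarrow> act (u @ [i]) (simple_root j) = act u (simple_root j) + act u (simple_root i)"
  using m_diag[of i]
  by (simp_all add: act_snoc simple_reflection_simple_root word_action_uminus word_action_add)

text \<open>
  The usual reduction to rank two: if \<open>u\<close> ends in \<open>j\<close>, either commute \<open>i\<close> past \<open>j\<close>, or use
  \<open>s\<^sub>j \<alpha>\<^sub>i = \<alpha>\<^sub>i + \<alpha>\<^sub>j\<close>, or strip both \<open>i\<close> and \<open>j\<close>.
\<close>

lemma reduced_nonneg:
  "reduced (u @ [i]) \<Longrightarrow> nonneg (act u (simple_root i))"
proof (induction "length u" arbitrary: u i rule: less_induct)
  case less
  show ?case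
  proof (cases u rule: rev_exhaust)
    case Nil
    then show ?thesis
      by (simp add: nonneg_def lookup_simple_root)
  next
    case (snoc x j)
    have r: "reduced (x @ [j, i])"
      using less.prems snoc by simp
    then have l: "x \<in> lists I" "i \<in> I" "j \<in> I"
      using reduced_lists[OF r] by auto
    have rx: "reduced x" "reduced (x @ [j])"
      using reduced_infix[of "[]" x "[j, i]"] reduced_infix[of "[]" "x @ [j]" "[i]"] r by auto
    have "i \<noteq> j"
      using reduced_no_square[of x i "[]"] r by auto
    with l(2,3) show ?thesis
    proof (cases rule: m_cases)
      case 1
      have "wp (x @ [i, j]) = wp (x @ [j, i])"
        using wp_context[of x "[]" "[i, j]" "[j, i]"] wp_commute[of i j] l 1 by simp
      then have "reduced (x @ [i, j])"
        using reduced_transfer[OF r, of "x @ [i, j]"] l by simp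
      then have "reduced (x @ [i])"
        using reduced_infix[of "[]" "x @ [i]" "[j]"] by simp
      then show ?thesis
        using less.hyps[of x i] act_snoc_root(2)[OF 1(1), of x] by (simp add: snoc)
    next
      case 2
      show ?thesis
      proof (cases "reduced (x @ [i])")
        case True
        then have "nonneg (act x (simple_root i))" "nonneg (act x (simple_root j))"
          using less.hyps[of x] rx snoc by simp_all
        then show ?thesis
          using act_snoc_root(3)[OF 2(1), of x] by (simp add: snoc nonneg_def lookup_add)
      next
        \<comment> \<open>Now \<open>v @ [i]\<close> represents the same element as
          \<open>x\<close>, so \<open>u @ [i]\<close> braids to \<open>v @ [j, i, j]\<close>, and
          \<open>s_i s_j \<alpha>_i = \<alpha>_j\<close> reduces the claim to the shorter word
          \<open>v\<close> with \<open>j\<close>.\<close>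
        case False
        obtain v where v: "reduced (v @ [i])" "wp (v @ [i]) = wp x"
          using descent[OF rx(1) l(2) False] .
        have vl: "v \<in> lists I"
          using reduced_lists[OF v(1)] by auto
        have len: "length (v @ [i]) = length x"
          using reduced_length[OF v(1) rx(1) v(2)] .
        have wpx: "wp (v @ [i] @ z) = wp (x @ z)" if "z \<in> lists I" for z
          using wp_context[of "[]" z "v @ [i]" x] v(2) vl l that by simp
        have "wp (v @ [j, i, j]) = wp (v @ [i, j, i])"
          using wp_context[of v "[]" "[j, i, j]" "[i, j, i]"] wp_braid[of i j] 2 vl l by simp
        also have "\<dots> = wp (x @ [j, i])"
          using wpx[of "[j, i]"] l by simp
        finally have "reduced (v @ [j, i, j])"
          using reduced_transfer[OF r, of "v @ [j, i, j]"] vl l len by simp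
        then have "reduced (v @ [j])"
          using reduced_infix[of "[]" "v @ [j]" "[i, j]"] by simp
        then have nn: "nonneg (act v (simple_root j))"
          using less.hyps[of v j] len snoc by simp
        have "act (x @ [j]) = act ((v @ [i]) @ [j])"
          using wpx[of "[j]"] l vl by (intro act_cong) auto
        then have "act u (simple_root i) = act ((v @ [i]) @ [j]) (simple_root i)"
          by (simp add: snoc)
        also have "\<dots> = act v (simple_root j)"
          using act_snoc_root(3)[OF 2(1), of "v @ [i]"] act_snoc_root(3)[OF 2(2), of v]
            act_snoc_root(1)[OF l(2), of v] by simp
        finally show ?thesis
          using nn by simp
      qed
    qed
  qed
qed

lemma not_reduced_nonpos:
  assumes "reduced u" "i \<in> I" "\<not> reduced (u @ [i])"
  shows "nonneg (- act u (simple_root i))"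
proof -
  obtain v where v: "reduced (v @ [i])" "wp (v @ [i]) = wp u"
    using descent[OF assms] .
  then have "act u = act (v @ [i])"
    using act_cong reduced_lists assms(1) by metis
  then show ?thesis
    using reduced_nonneg[OF v(1)] act_snoc_root(1)[OF assms(2)] by simp
qed

text \<open>Otherwise the root would have both signs and vanish, against injectivity of the
  action.\<close>

lemma nonpos_not_reduced:
  assumes "u \<in> lists I" "nonneg (- act u (simple_root i))"
  shows "\<not> reduced (u @ [i])"
proof
  assume "reduced (u @ [i])"
  then have "Poly_Mapping.lookup (act u (simple_root i)) k = 0" for k
    using reduced_nonneg[of u i] assms(2) by (simp add: nonneg_def order_antisym)
  then have "act u (simple_root i) = act u 0"
    by (intro poly_mapping_eqI) (simp add: word_action_zero)
  then have "simple_root i = 0"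
    using act_inj[OF assms(1)] by blast
  then show False
    using lookup_simple_root[of i i] by simp
qed

section \<open>Braid moves\<close>

definition braid_move :: "'i list \<Rightarrow> 'i list \<Rightarrow> bool" where
  "braid_move u v \<longleftrightarrow> commutation_step I m u v \<or>
     (\<exists>x y i j. x \<in> lists I \<and> y \<in> lists I \<and> bond i j \<and> u = x @ [i, j, i] @ y \<and> v = x @ [j, i, j] @ y)"

lemma braid_moveI1:
  "x \<in> lists I \<Longrightarrow> y \<in> lists I \<Longrightarrow> i \<in> I \<Longrightarrow> j \<in> I \<Longrightarrow> m i j = 2 \<Longrightarrow> braid_move (x @ [i, j] @ y) (x @ [j, i] @ y)"
  unfolding braid_move_def by (blast intro: commutation_step.intros)

lemma braid_moveI2:
  "x \<in> lists I \<Longrightarrow> y \<in> lists I \<Longrightarrow> bond i j \<Longrightarrow> braid_move (x @ [i, j, i] @ y) (x @ [j, i, j] @ y)"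
  unfolding braid_move_def by blast

lemma commutation_step_sym: "commutation_step I m u v \<Longrightarrow> commutation_step I m v u"
  by (erule commutation_step.cases) (simp only:, rule commutation_step.intros, use m_sym in auto)

lemma braid_moves_snoc:
  assumes "braid_move\<^sup>*\<^sup>* u v" "k \<in> I"
  shows "braid_move\<^sup>*\<^sup>* (u @ [k]) (v @ [k])"
  using assms(1)
proof (induction rule: rtranclp_induct)
  case (step v w)
  from step(2) have "braid_move (v @ [k]) (w @ [k])"
    unfolding braid_move_def
  proof (elim disjE exE conjE)
    assume "commutation_step I m v w"
    then have "commutation_step I m (v @ [k]) (w @ [k])"
    proof cases
      case (1 x y i j)
      then show ?thesis
        using commutation_step.intros[of x I "y @ [k]" i j m] assms(2) by simp
    qed
    then show "commutation_step I m (v @ [k]) (w @ [k]) \<or> (\<exists>x y i j. x \<in> lists I \<and> y \<in> lists I \<and>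
        bond i j \<and> v @ [k] = x @ [i, j, i] @ y \<and> w @ [k] = x @ [j, i, j] @ y)" ..
  next
    fix x y i j
    assume "x \<in> lists I" "y \<in> lists I" "bond i j" "v = x @ [i, j, i] @ y" "w = x @ [j, i, j] @ y"
    then have "x \<in> lists I \<and> y @ [k] \<in> lists I \<and>
        bond i j \<and> v @ [k] = x @ [i, j, i] @ (y @ [k]) \<and> w @ [k] = x @ [j, i, j] @ (y @ [k])"
      using assms(2) by simp
    then show "commutation_step I m (v @ [k]) (w @ [k]) \<or> (\<exists>x y i j. x \<in> lists I \<and> y \<in> lists I \<and>
        bond i j \<and> v @ [k] = x @ [i, j, i] @ y \<and> w @ [k] = x @ [j, i, j] @ y)"
      by blast
  qed
  then show ?case
    using step.IH by (rule rtranclp.rtrancl_into_rtrancl[rotated])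
qed simp

text \<open>Suppose the last letters \<open>i\<close> and \<open>j\<close> differ. Both shorten the
  element, and the signs of roots produce a word for it ending in \<open>[j, i]\<close> or
  \<open>[i, j, i]\<close>. One move changes its last letter from \<open>i\<close> to
  \<open>j\<close>; the induction hypothesis connects it to \<open>u\<close> before the move and to
  \<open>v\<close> after it.\<close>

theorem matsumoto:
  "reduced u \<Longrightarrow> reduced v \<Longrightarrow> wp u = wp v \<Longrightarrow> braid_move\<^sup>*\<^sup>* u v"
proof (induction "length u" arbitrary: u v rule: less_induct)
  case less
  have len: "length u = length v"
    using reduced_length less.prems by blast
  show ?case
  proof (cases u rule: rev_exhaust)
    case Nil
    then show ?thesis
      using len by simp
  next
    case u: (snoc u' i)
    then obtain v' j where v: "v = v' @ [j]"
      using len by (cases v rule: rev_exhaust) auto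
    have l: "u' \<in> lists I" "v' \<in> lists I" "i \<in> I" "j \<in> I"
      using reduced_lists[OF less.prems(1)] reduced_lists[OF less.prems(2)] u v by auto
    have ru: "reduced u'" and rv: "reduced v'"
      using reduced_infix[of "[]" u' "[i]"] reduced_infix[of "[]" v' "[j]"] less.prems u v by simp_all
    have eq: "wp (u' @ [i]) = wp (v' @ [j])"
      using less.prems(3) u v by simp
    have IH: "braid_move\<^sup>*\<^sup>* (u' @ [i]) (x @ [i])"
      if "x \<in> lists I" "wp x = wp u'" "length x = length u'" for x
    proof -
      have "reduced x"
        using reduced_transfer[OF ru that(1,2)] that(3) by simp
      then show ?thesis
        using less.hyps[of u' x] ru that(2) u l(3) by (auto intro: braid_moves_snoc)
    qed
    have IH': "braid_move\<^sup>*\<^sup>* (x @ [j]) (v' @ [j])"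
      if "x \<in> lists I" "wp x = wp v'" "length x = length v'" for x
    proof -
      have "reduced x"
        using reduced_transfer[OF rv that(1,2)] that(3) by simp
      then show ?thesis
        using less.hyps[of x v'] rv that u v len l(4) by (auto intro: braid_moves_snoc)
    qed
    show ?thesis
    proof (cases "i = j")
      case True
      then have "wp v' = wp u'"
        using wp_cancel_right[of v' u' i] eq l by simp
      then show ?thesis
        using IH[of v'] l u v True len by simp
    next
      case False
      have r: "reduced (u' @ [i])"
        using less.prems(1) u by simp
      have nr: "\<not> reduced ((u' @ [i]) @ [j])"
      proof
        assume "reduced ((u' @ [i]) @ [j])"
        moreover have "wp ((u' @ [i]) @ [j]) = wp ((v' @ [j]) @ [j])"
          using wp_append[of "u' @ [i]" "[j]"] wp_append[of "v' @ [j]" "[j]"] l eq by simp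
        then have "wp v' = wp ((u' @ [i]) @ [j])"
          using wp_snoc_snoc[OF l(2,4)] by simp
        ultimately have "length ((u' @ [i]) @ [j]) \<le> length v'"
          using l(2) unfolding reduced_def by blast
        then show False
          using len u v by simp
      qed
      then have neg: "nonneg (- act (u' @ [i]) (simple_root j))"
        by (rule not_reduced_nonpos[OF r l(4)])
      from l(3,4) False show ?thesis
      proof (cases rule: m_cases)
        case 1
        then have "\<not> reduced (u' @ [j])"
          using nonpos_not_reduced[OF l(1)] neg act_snoc_root(2)[OF 1(2), of u'] by simp
        then obtain x where x: "reduced (x @ [j])" "wp (x @ [j]) = wp u'"
          using descent[OF ru l(4)] by blast
        have xl: "x \<in> lists I"
          using reduced_lists[OF x(1)] by simp
        have lx: "length (x @ [j]) = length u'"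
          using reduced_length[OF x(1) ru x(2)] .
        have xji: "wp (x @ [j, i]) = wp (u' @ [i])"
          using wp_context[of "[]" "[i]" "x @ [j]" u'] x(2) xl l by simp
        have xij: "wp (x @ [i, j]) = wp (x @ [j, i])"
          using wp_context[of x "[]" "[i, j]" "[j, i]"] wp_commute[OF l(3,4) 1(1)] xl l by simp
        have "wp (x @ [i]) = wp v'"
          using wp_cancel_right[of "x @ [i]" v' j] xl l xij xji eq by simp
        then have "braid_move\<^sup>*\<^sup>* (x @ [i, j]) v"
          using IH'[of "x @ [i]"] xl l lx len u v by simp
        moreover have "braid_move (x @ [j, i]) (x @ [i, j])"
          using braid_moveI1[of x "[]" j i] xl l 1 by simp
        moreover have "braid_move\<^sup>*\<^sup>* u (x @ [j, i])"
          using IH[of "x @ [j]"] xl l x(2) lx u by simp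
        ultimately show ?thesis
          by (meson converse_rtranclp_into_rtranclp rtranclp_trans)
      next
        case 2
        \<comment> \<open>A nonpositive vector minus a nonnegative one: \<open>j\<close> also
          shortens \<open>u'\<close>.\<close>
        have "act u' (simple_root j) = act (u' @ [i]) (simple_root j) - act u' (simple_root i)"
          using act_snoc_root(3)[OF 2(2), of u'] by simp
        then have "nonneg (- act u' (simple_root j))"
          using neg reduced_nonneg[OF r] by (simp add: nonneg_def lookup_minus) (meson order_trans)
        then have "\<not> reduced (u' @ [j])"
          using nonpos_not_reduced[OF l(1)] by simp
        then obtain x where x: "reduced (x @ [j])" "wp (x @ [j]) = wp u'"
          using descent[OF ru l(4)] by blast
        have xl: "x \<in> lists I" and rx: "reduced x"
          using reduced_lists[OF x(1)] reduced_infix[of "[]" x "[j]"] x(1) by simp_all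
        have lx: "length (x @ [j]) = length u'"
          using reduced_length[OF x(1) ru x(2)] .
        have "wp (x @ [j] @ [i]) = wp (u' @ [i])"
          using wp_context[of "[]" "[i]" "x @ [j]" u'] x(2) xl l by simp
        then have "act (u' @ [i]) = act ((x @ [j]) @ [i])"
          using xl l by (intro act_cong) auto
        \<comment> \<open>Since \<open>s_j s_i \<alpha>_j = \<alpha>_i\<close>, the sign already
          known yields a descent of \<open>x\<close> at \<open>i\<close>.\<close>
        then have "act (u' @ [i]) (simple_root j) = act x (simple_root i)"
          using act_snoc_root(3)[OF 2(2), of "x @ [j]"] act_snoc_root(3)[OF 2(1), of x]
            act_snoc_root(1)[OF l(4), of x] by simp
        then have "\<not> reduced (x @ [i])"
          using nonpos_not_reduced[OF xl] neg by simp
        then obtain y where y: "reduced (y @ [i])" "wp (y @ [i]) = wp x"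
          using descent[OF rx l(3)] by blast
        have yl: "y \<in> lists I"
          using reduced_lists[OF y(1)] by simp
        have ly: "length (y @ [i]) = length x"
          using reduced_length[OF y(1) rx y(2)] .
        have yij: "wp (y @ [i, j]) = wp u'"
          using wp_context[of "[]" "[j]" "y @ [i]" x] x(2) y(2) xl yl l by simp
        have yiji: "wp (y @ [i, j, i]) = wp (u' @ [i])"
          using wp_context[of "[]" "[i]" "y @ [i, j]" u'] yij yl l by simp
        have "wp (y @ [j, i, j]) = wp (y @ [i, j, i])"
          using wp_context[of y "[]" "[j, i, j]" "[i, j, i]"] wp_braid[OF l(3,4) 2(1)] yl l by simp
        then have "wp (y @ [j, i]) = wp v'"
          using wp_cancel_right[of "y @ [j, i]" v' j] yl l yiji eq by simp
        then have "braid_move\<^sup>*\<^sup>* (y @ [j, i, j]) v"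
          using IH'[of "y @ [j, i]"] yl l lx ly len u v by simp
        moreover have "braid_move (y @ [i, j, i]) (y @ [j, i, j])"
          using braid_moveI2[of y "[]" i j] yl l 2 by (simp add: bond_def)
        moreover have "braid_move\<^sup>*\<^sup>* u (y @ [i, j, i])"
          using IH[of "y @ [i, j]"] yl l yij lx ly u by simp
        ultimately show ?thesis
          by (meson converse_rtranclp_into_rtranclp rtranclp_trans)
      qed
    qed
  qed
qed

section \<open>Fully commutative and freely braided elements\<close>

lemma pattern_append: "pattern adj i (u @ v) = pattern adj i u @ pattern adj i v"
  by (simp add: pattern_def)

lemma well_spaced_prefix:
  assumes "well_spaced adj (u @ v)"
  shows "well_spaced adj u"
  using assms unfolding well_spaced_def pattern_append by (metis append_assoc)

lemma well_spaced_no_square: "\<not> well_spaced adj (x @ [i, i] @ y)"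
proof -
  have "pattern adj i (x @ [i, i] @ y) = pattern adj i x @ [True, True] @ pattern adj i y"
    by (simp add: pattern_def)
  then show ?thesis
    unfolding well_spaced_def by blast
qed

lemma well_spaced_no_braid:
  assumes "bond i j"
  shows "\<not> well_spaced bond (x @ [i, j, i] @ y)"
proof -
  have "i \<noteq> j"
    using assms m_diag by (auto simp: bond_def)
  then have "pattern bond i (x @ [i, j, i] @ y) = pattern bond i x @ [True, False, True] @ pattern bond i y"
    using assms by (simp add: pattern_def)
  then show ?thesis
    unfolding well_spaced_def by blast
qed

text \<open>If the filter keeps both commuting letters, neither is \<open>k\<close> and both are
  recorded as \<open>False\<close>; this is why the pattern forgets which neighbour occurs.\<close>

lemma pattern_commutation:
  assumes "commutation_step I m u v"
  shows "pattern bond k u = pattern bond k v"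
  using assms
proof cases
  case (1 x y i j)
  have "i \<noteq> j" "\<not> bond i j" "\<not> bond j i"
    using 1 m_diag[of i] m_sym[of i j] by (auto simp: bond_def)
  then show ?thesis
    using 1 by (auto simp: pattern_def)
qed

text \<open>No braid applies to a well spaced word, and commutations keep it well spaced, so every
  move of the chain is a commutation.\<close>

lemma well_spaced_braid_moves:
  assumes "braid_move\<^sup>*\<^sup>* u v" "well_spaced bond u"
  shows "well_spaced bond v \<and> commutation_equivalent I m u v"
  using assms(1)
proof (induction rule: rtranclp_induct)
  case base
  then show ?case
    using assms(2) by (simp add: commutation_equivalent_def)
next
  case (step v w)
  have c: "commutation_step I m v w"
    using step well_spaced_no_braid unfolding braid_move_def by blast
  moreover have "well_spaced bond w"
    using step.IH pattern_commutation[OF c] unfolding well_spaced_def by simp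
  ultimately show ?case
    using step.IH unfolding commutation_equivalent_def by (meson rtranclp.rtrancl_into_rtrancl)
qed

text \<open>Were \<open>u @ [i]\<close> not reduced, Matsumoto's theorem for \<open>u\<close> and a
  reduced word \<open>v @ [i]\<close> would give moves from \<open>u @ [i]\<close> to
  \<open>v @ [i, i]\<close>. These preserve well-spacedness, which a square violates.\<close>

lemma well_spaced_reduced: "well_spaced bond u \<Longrightarrow> u \<in> lists I \<Longrightarrow> reduced u"
proof (induction u rule: rev_induct)
  case Nil
  then show ?case
    by (simp add: reduced_def)
next
  case (snoc i u)
  have u: "reduced u" "i \<in> I"
    using snoc well_spaced_prefix[of bond u "[i]"] by auto
  show ?case
  proof (rule ccontr)
    assume "\<not> reduced (u @ [i])"
    then obtain v where v: "reduced (v @ [i])" "wp (v @ [i]) = wp u"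
      using descent[OF u] by blast
    then have "braid_move\<^sup>*\<^sup>* (u @ [i]) ((v @ [i]) @ [i])"
      using matsumoto[OF u(1) v(1)] u(2) braid_moves_snoc by metis
    then show False
      using well_spaced_braid_moves[of "u @ [i]"] snoc.prems(1) well_spaced_no_square[of bond v i "[]"] by simp
  qed
qed

lemma commutation_equivalent_sym:
  "commutation_equivalent I m u v \<Longrightarrow> commutation_equivalent I m v u"
  unfolding commutation_equivalent_def
  using sympD[OF symp_rtranclp] commutation_step_sym by (metis sympI)

lemma well_spaced_fully_commutative:
  assumes "well_spaced bond u" "u \<in> lists I"
  shows "fully_commutative (wp u)"
  unfolding fully_commutative_def
proof (intro allI impI)
  have *: "commutation_equivalent I m u v" if "reduced_expression v (wp u)" for v
    using well_spaced_braid_moves[OF matsumoto assms(1)] well_spaced_reduced[OF assms] that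
    by (simp add: reduced_expression_def)
  fix v w assume "reduced_expression v (wp u)" "reduced_expression w (wp u)"
  then show "commutation_equivalent I m v w"
    using * commutation_equivalent_sym unfolding commutation_equivalent_def by (meson rtranclp_trans)
qed

lemma count_list_commutation:
  "commutation_equivalent I m u v \<Longrightarrow> count_list u k = count_list v k"
  unfolding commutation_equivalent_def
proof (induction rule: rtranclp_induct)
  case (step v w)
  from step.hyps(2) have "count_list v k = count_list w k"
    by cases simp
  with step.IH show ?case
    by simp
qed simp

section \<open>Labels of reduced words under moves\<close>

lemma labelled_pair:
  assumes "labelled m u = A @ (i, a) # (j, b) # E"
  shows "\<exists>x y. u = x @ [i, j] @ y \<and> E = labelled m y \<and> length x = length A \<and>
    b = act (rev y) (simple_root j) \<and> a = act (rev y @ [j]) (simple_root i)"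
proof -
  have "(i, a) # (j, b) # E = labelled m (i # j # map fst E)" "u = map fst A @ i # j # map fst E"
    using labelled_eq_append[OF assms] by simp_all
  then show ?thesis
    by (intro exI[of _ "map fst A"] exI[of _ "map fst E"]) simp
qed

lemma labelled_triple:
  assumes "labelled m u = A @ (i, a) # (j, b) # (k, c) # E"
  shows "\<exists>x y. u = x @ [i, j, k] @ y \<and> E = labelled m y \<and> length x = length A \<and>
    c = act (rev y) (simple_root k) \<and> b = act (rev y @ [k]) (simple_root j) \<and>
    a = act (rev y @ [k, j]) (simple_root i)"
proof -
  have "(i, a) # (j, b) # (k, c) # E = labelled m (i # j # k # map fst E)" "u = map fst A @ i # j # k # map fst E"
    using labelled_eq_append[OF assms] by simp_all
  then show ?thesis
    by (intro exI[of _ "map fst A"] exI[of _ "map fst E"]) simp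
qed

text \<open>The labels on \<open>x\<close> depend on what follows only through its action, hence
  only through the group element.\<close>

lemma labelled_replace:
  assumes u: "labelled m (x @ z @ y) = A @ E" and len: "length x = length A"
    and l: "x \<in> lists I" "z \<in> lists I" "z' \<in> lists I" "y \<in> lists I" and eq: "wp z = wp z'"
  shows "labelled m (x @ z' @ y) = A @ labelled m (z' @ y)"
proof -
  have "wp (z @ y) = wp (z' @ y)"
    using wp_context[of "[]" y z z'] l eq by simp
  then have "wp (rev (z @ y)) = wp (rev (z' @ y))"
    using wp_rev[of "z @ y"] wp_rev[of "z' @ y"] l by simp
  moreover have "rev (z @ y) \<in> lists I" "rev (z' @ y) \<in> lists I"
    using l by (auto intro!: rev_lists simp del: rev_append)
  ultimately have "act (rev (z @ y)) = act (rev (z' @ y))"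
    by (rule act_cong[rotated 2])
  then have "labelled m (x @ z' @ y) =
      map (apsnd (act (rev (z @ y)))) (labelled m x) @ labelled m (z' @ y)"
    by (simp only: labelled_append[of m x])
  moreover have "map (apsnd (act (rev (z @ y)))) (labelled m x) = A"
    using u len by (simp add: labelled_append[of m x])
  ultimately show ?thesis
    by simp
qed

lemma reduced_replace:
  assumes "reduced_expression (x @ z @ y) w" "z' \<in> lists I" "wp z' = wp z" "length z' = length z"
  shows "reduced_expression (x @ z' @ y) w"
proof -
  have l: "x \<in> lists I" "y \<in> lists I" "z \<in> lists I"
    using assms(1) reduced_lists[of "x @ z @ y"] by (auto simp: reduced_expression_def)
  have "wp (x @ z' @ y) = wp (x @ z @ y)"
    using wp_context[of x y z' z] l assms by blast
  then show ?thesis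
    using assms l reduced_transfer[of "x @ z @ y" "x @ z' @ y"] by (simp add: reduced_expression_def)
qed

text \<open>If the label of the first letter \<open>i\<close> recurred at \<open>j\<close>, with
  \<open>p\<close> in between, cancelling the common right part would make
  \<open>act (rev p)\<close> send \<open>\<alpha>_i\<close> to \<open>- \<alpha>_j\<close>, although
  \<open>i # p\<close> is reduced.\<close>

lemma labelled_distinct: "reduced u \<Longrightarrow> distinct (map snd (labelled m u))"
proof (induction u)
  case (Cons i u)
  have u: "reduced u"
    using reduced_infix[of "[i]" u "[]"] Cons.prems by simp
  have "act (rev u) (simple_root i) \<notin> snd ` set (labelled m u)"
  proof
    assume "act (rev u) (simple_root i) \<in> snd ` set (labelled m u)"
    then obtain j where "(j, act (rev u) (simple_root i)) \<in> set (labelled m u)"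
      by force
    then obtain A E where AE: "labelled m u = A @ (j, act (rev u) (simple_root i)) # E"
      by (meson split_list)
    define p q where "p = map fst A" and "q = map fst E"
    have "(j, act (rev u) (simple_root i)) # E = labelled m (j # q)" and up: "u = p @ j # q"
      using labelled_eq_append[OF AE] by (simp_all add: p_def q_def)
    then have eq: "act (rev u) (simple_root i) = act (rev q) (simple_root j)"
      by simp
    have l: "p \<in> lists I" "q \<in> lists I" "j \<in> I" "i \<in> I"
      using reduced_lists[OF Cons.prems] up by auto
    have "act (rev q) (act [j] (act (rev p) (simple_root i))) = act (rev q) (simple_root j)"
      using eq up by (simp add: word_action_append word_action_Cons)
    then have "act [j] (act (rev p) (simple_root i)) = simple_root j"
      using act_inj[OF rev_lists[OF l(2)]] by blast
    then have "act (rev p) (simple_root i) = act [j] (simple_root j)"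
      using act_rev(1)[of "[j]" "act (rev p) (simple_root i)"] l(3) by simp
    also have "\<dots> = - simple_root j"
      using simple_reflection_simple_root(1)[of m j] m_diag[OF l(3)] by (simp add: word_action_Cons)
    finally have "act (rev p) (simple_root i) = - simple_root j" .
    moreover have "reduced (i # p)"
      using reduced_infix[of "[]" "i # p" "j # q"] Cons.prems up by simp
    then have "nonneg (act (rev p) (simple_root i))"
      using reduced_rev[of "i # p"] reduced_nonneg[of "rev p" i] by simp
    ultimately have "0 \<le> Poly_Mapping.lookup (- simple_root j) j"
      unfolding nonneg_def by metis
    then show False
      by (simp add: lookup_simple_root lookup_uminus)
  qed
  then show ?case
    using Cons.IH[OF u] by simp
qed simp

lemma pos_rootI:
  assumes "reduced (u @ [i])"
  shows "act u (simple_root i) \<in> pos_roots"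
proof -
  have l: "u \<in> lists I" "i \<in> I"
    using reduced_lists[OF assms] by auto
  have "act u (simple_root i) = action (wp u) (simple_root i)"
    using action_word_prod[OF simply_laced l(1)] by simp
  then have "act u (simple_root i) \<in> roots"
    using l wp_closed[OF l(1)] unfolding roots_def by blast
  then show ?thesis
    using reduced_nonneg[OF assms] by (simp add: pos_roots_def nonneg_def)
qed

text \<open>In \<open>u = x @ [i] @ y\<close> the part \<open>y\<close> undoes the action that
  defines the root and \<open>s_i\<close> flips the sign, leaving minus the positive root of
  \<open>x @ [i]\<close>.\<close>

lemma label_inversion:
  assumes "reduced u" "labelled m u = A @ (i, r) # E"
  shows "r \<in> inversion_set (wp u)"
proof -
  define x y where "x = map fst A" and "y = map fst E"
  have "(i, r) # E = labelled m (i # y)" and u: "u = x @ [i] @ y"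
    using labelled_eq_append[OF assms(2)] by (simp_all add: x_def y_def)
  then have r: "r = act (rev y) (simple_root i)"
    by simp
  have l: "u \<in> lists I" "x \<in> lists I" "y \<in> lists I" "i \<in> I"
    using reduced_lists[OF assms(1)] u by auto
  have "reduced (i # y)"
    using reduced_infix[of x "i # y" "[]"] assms(1) u by simp
  then have pos: "r \<in> pos_roots"
    using reduced_rev[of "i # y"] pos_rootI[of "rev y" i] r by simp
  have "reduced (x @ [i])"
    using reduced_infix[of "[]" "x @ [i]" y] assms(1) u by simp
  then have x: "act x (simple_root i) \<in> pos_roots"
    by (rule pos_rootI)
  have "act u r = act (x @ [i]) (act y (act (rev y) (simple_root i)))"
    by (simp add: r u word_action_append word_action_Cons)
  also have "\<dots> = - act x (simple_root i)"
    using act_rev(2)[OF l(3)] act_snoc_root(1)[OF l(4)] by simp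
  finally have "act u r \<in> neg_roots"
    using x by (simp add: neg_roots_def)
  moreover have "r = action (inv (wp u)) (act u r)"
    using act_rev(1)[OF l(1)] wp_rev[OF l(1)] action_word_prod[OF simply_laced rev_lists[OF l(1)]] by simp
  ultimately show ?thesis
    unfolding inversion_set_def using pos by blast
qed

text \<open>In rank two the middle root is the sum of the outer ones; \<open>root_sequence\<close>
  lists the three in the opposite order.\<close>

lemma braid_contractible:
  assumes u: "reduced_expression u w" and l: "labelled m u = A @ (i, a) # (j, b) # (i, c) # E"
    and ij: "bond i j"
  shows "inversion_triple w {a, b, c} \<and> contractible w {a, b, c}"
proof -
  obtain x y where xy: "u = x @ [i, j, i] @ y" "c = act (rev y) (simple_root i)"
      "b = act (rev y @ [i]) (simple_root j)" "a = act (rev y @ [i, j]) (simple_root i)"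
    using labelled_triple[OF l] by blast
  have m: "i \<in> I" "m i j = 3" "m j i = 3"
    using ij bond_sym[OF ij] by (auto simp: bond_def)
  have b: "b = act (rev y) (simple_root j) + c"
    using act_snoc_root(3)[OF m(3)] xy by simp
  have "a = act ((rev y @ [i]) @ [j]) (simple_root i)"
    using xy by simp
  also have "\<dots> = act (rev y @ [i]) (simple_root i) + b"
    using act_snoc_root(3)[OF m(2), of "rev y @ [i]"] xy(3) by simp
  also have "\<dots> = act (rev y) (simple_root j)"
    using act_snoc_root(1)[OF m(1)] b xy(2) by simp
  finally have "b = a + c"
    using b by simp
  have r: "reduced u" "wp u = w"
    using u by (auto simp: reduced_expression_def)
  have "a \<in> inversion_set w" "b \<in> inversion_set w" "c \<in> inversion_set w"
    using label_inversion[OF r(1), of A] label_inversion[OF r(1), of "A @ [(i, a)]"]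
      label_inversion[OF r(1), of "A @ [(i, a), (j, b)]"] l r(2) by auto
  moreover have "{a, b, c} = {a, c, a + c}"
    using \<open>b = a + c\<close> by blast
  ultimately have "inversion_triple w {a, b, c}"
    unfolding inversion_triple_def by (metis empty_subsetI insert_subset)
  moreover have "root_sequence m u = rev (map snd E) @ [c, b, a] @ rev (map snd A)"
    by (simp add: root_sequence_eq l)
  then have "contractible w {a, b, c}"
    unfolding contractible_def
    by (intro exI[of _ u] exI[of _ "rev (map snd E)"] exI[of _ "[c, b, a]"] exI[of _ "rev (map snd A)"])
      (use u in auto)
  ultimately show ?thesis ..
qed

text \<open>A commutation carries the labels with the letters, while a braid reverses the three
  labels because \<open>s_i s_j \<alpha>_i = \<alpha>_j\<close>. Labels further left survive by
  \<open>labelled_replace\<close>.\<close>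

lemma freely_braided_closed:
  assumes fb: "freely_braided w"
  shows "braid_closed bond {labelled m u | u. reduced_expression u w}"
proof
  let ?L = "{labelled m u | u. reduced_expression u w}"
  have lists: "u \<in> lists I" if "reduced_expression u w" for u
    using reduced_lists that by (auto simp: reduced_expression_def)
  show "\<not> bond i i" for i
    using m_diag[of i] by (auto simp: bond_def)
  show "bond j i" if "bond i j" for i j
    using bond_sym that .
  show "A @ (j, b) # (i, a) # E \<in> ?L"
    if L: "A @ (i, a) # (j, b) # E \<in> ?L" and ij: "i \<noteq> j" "\<not> bond i j" for A i a j b E
  proof -
    obtain u where u: "labelled m u = A @ (i, a) # (j, b) # E" "reduced_expression u w"
      using L by auto
    obtain x y where xy: "u = x @ [i, j] @ y" "E = labelled m y" "length x = length A"
        "b = act (rev y) (simple_root j)" "a = act (rev y @ [j]) (simple_root i)"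
      using labelled_pair[OF u(1)] by blast
    have l: "x \<in> lists I" "y \<in> lists I" "i \<in> I" "j \<in> I"
      using lists[OF u(2)] xy(1) by auto
    have m: "m i j = 2" "m j i = 2"
      using m_cases[OF l(3,4) ij(1)] ij(2) l by (auto simp: bond_def)
    have e: "wp [i, j] = wp [j, i]"
      using wp_commute l m by blast
    have "labelled m (x @ [j, i] @ y) = A @ labelled m ([j, i] @ y)"
      using labelled_replace[of x "[i, j]" y A "(i, a) # (j, b) # E" "[j, i]"] u(1) xy(1,3) l e by simp
    also have "labelled m ([j, i] @ y) = (j, b) # (i, a) # E"
      using xy act_snoc_root(2)[OF m(1)] act_snoc_root(2)[OF m(2)] by simp
    finally have "labelled m (x @ [j, i] @ y) = A @ (j, b) # (i, a) # E" .
    moreover have "reduced_expression (x @ [j, i] @ y) w"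
      using reduced_replace[of x "[i, j]" y w "[j, i]"] u(2) xy(1) l e by simp
    ultimately show ?thesis
      by (metis (mono_tags, lifting) mem_Collect_eq)
  qed
  show "A @ (j, c) # (i, b) # (j, a) # E \<in> ?L"
    if L: "A @ (i, a) # (j, b) # (i, c) # E \<in> ?L" and ij: "bond i j" for A i a j b c E
  proof -
    obtain u where u: "labelled m u = A @ (i, a) # (j, b) # (i, c) # E" "reduced_expression u w"
      using L by auto
    obtain x y where xy: "u = x @ [i, j, i] @ y" "E = labelled m y" "length x = length A"
        "c = act (rev y) (simple_root i)" "b = act (rev y @ [i]) (simple_root j)"
        "a = act (rev y @ [i, j]) (simple_root i)"
      using labelled_triple[OF u(1)] by blast
    have l: "x \<in> lists I" "y \<in> lists I" "i \<in> I" "j \<in> I"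
      using lists[OF u(2)] xy(1) by auto
    have m: "m i j = 3" "m j i = 3"
      using ij bond_sym[OF ij] by (auto simp: bond_def)
    have e: "wp [i, j, i] = wp [j, i, j]"
      using wp_braid l m by blast
    have two: "act (v @ [k, k']) (simple_root k) = act v (simple_root k')"
      if "k \<in> I" "m k k' = 3" "m k' k = 3" for v k k'
      using act_snoc_root(3)[OF that(2), of "v @ [k]"] act_snoc_root(3)[OF that(3), of v]
        act_snoc_root(1)[OF that(1), of v] by simp
    have "labelled m (x @ [j, i, j] @ y) = A @ labelled m ([j, i, j] @ y)"
      using labelled_replace[of x "[i, j, i]" y A "(i, a) # (j, b) # (i, c) # E" "[j, i, j]"]
        u(1) xy(1,3) l e by simp
    also have "labelled m ([j, i, j] @ y) = (j, c) # (i, b) # (j, a) # E"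
      using xy two[of i j] two[of j i] m l act_snoc_root(3)[OF m(1), of "rev y"]
        act_snoc_root(3)[OF m(2), of "rev y"] by (simp add: add.commute)
    finally have "labelled m (x @ [j, i, j] @ y) = A @ (j, c) # (i, b) # (j, a) # E" .
    moreover have "reduced_expression (x @ [j, i, j] @ y) w"
      using reduced_replace[of x "[i, j, i]" y w "[j, i, j]"] u(2) xy(1) l e by simp
    ultimately show ?thesis
      by (metis (mono_tags, lifting) mem_Collect_eq)
  qed
  show "A @ (i, a) # (i, b) # E \<notin> ?L" for A i a b E
  proof
    assume "A @ (i, a) # (i, b) # E \<in> ?L"
    then obtain u where u: "labelled m u = A @ (i, a) # (i, b) # E" "reduced_expression u w"
      by auto
    then show False
      using labelled_pair[OF u(1)] reduced_no_square by (auto simp: reduced_expression_def)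
  qed
  show "distinct (map snd L)" if "L \<in> ?L" for L
    using that labelled_distinct by (auto simp: reduced_expression_def)
  show "{a, b, c} = {a', b', c'}"
    if L: "A @ (i, a) # (j, b) # (i, c) # E \<in> ?L" "bond i j"
      "A' @ (i', a') # (j', b') # (i', c') # E' \<in> ?L" "bond i' j'"
      and meet: "{a, b, c} \<inter> {a', b', c'} \<noteq> {}"
    for A i a j b c E A' i' a' j' b' c' E'
  proof -
    let ?T = "{T. inversion_triple w T \<and> contractible w T}"
    have "{a, b, c} \<in> ?T" "{a', b', c'} \<in> ?T"
      using braid_contractible[OF _ _ L(2)] braid_contractible[OF _ _ L(4)] L(1,3)
      by (smt (verit) mem_Collect_eq)+
    moreover have "disjnt {a, b, c} {a', b', c'}" if "{a, b, c} \<noteq> {a', b', c'}"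
      using fb calculation that unfolding freely_braided_def by (rule pairwiseD)
    ultimately show ?thesis
      using meet unfolding disjnt_def by metis
  qed
qed

section \<open>Fully commutative elements are freely braided\<close>

lemma fully_commutative_not_contractible:
  assumes fc: "fully_commutative w" and T: "inversion_triple w T"
  shows "\<not> contractible w T"
proof
  assume "contractible w T"
  then obtain u xs ys zs where u: "reduced_expression u w" "root_sequence m u = xs @ ys @ zs"
      and ys: "length ys = 3" "set ys = T"
    unfolding contractible_def by blast
  have r: "reduced u"
    using u(1) by (simp add: reduced_expression_def)
  have "map snd (labelled m u) = rev zs @ rev ys @ rev xs"
    using u(2) unfolding root_sequence_eq by (metis append.assoc rev_append rev_rev_ident)
  then obtain A R where "labelled m u = A @ R" "map snd R = rev ys @ rev xs"
    by (metis map_eq_append_conv)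
  then obtain Y E where AYE: "labelled m u = A @ Y @ E" "map snd Y = rev ys"
    by (metis map_eq_append_conv)
  then have "length Y = 3"
    using ys(1) by (metis length_map length_rev)
  then obtain p r1 q r2 k r3 where Y: "Y = [(p, r1), (q, r2), (k, r3)]"
    by (auto simp: numeral_3_eq_3 length_Suc_conv)
  then obtain x y where xy: "u = x @ [p, q, k] @ y" "r3 = act (rev y) (simple_root k)"
      "r2 = act (rev y @ [k]) (simple_root q)" "r1 = act (rev y @ [k, q]) (simple_root p)"
    using labelled_triple[of u A p r1 q r2 k r3 E] AYE by auto
  have l: "x \<in> lists I" "y \<in> lists I" "p \<in> I" "q \<in> I" "k \<in> I"
    using reduced_lists[OF r] xy(1) by auto
  have ne: "p \<noteq> q" "q \<noteq> k"
    using reduced_no_square[of x p "k # y"] reduced_no_square[of "x @ [p]" q y] r xy(1) by auto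
  have dist: "r1 \<noteq> r2" "r1 \<noteq> r3" "r2 \<noteq> r3"
    using labelled_distinct[OF r] AYE(1) Y by auto
  obtain a b where "T = {a, b, a + b}"
    using T unfolding inversion_triple_def by blast
  moreover have "set (rev ys) = {r1, r2, r3}"
    unfolding AYE(2)[symmetric] Y by simp
  then have "T = {r1, r2, r3}"
    using ys(2) by simp
  ultimately have "{r1, r2, r3} = {a, b, a + b}"
    by simp
  then have "r1 \<in> {a, b, a + b}" "r2 \<in> {a, b, a + b}" "r3 \<in> {a, b, a + b}"
    by blast+
  then have sum: "r1 = r2 + r3 \<or> r2 = r1 + r3 \<or> r3 = r1 + r2"
    using dist by (auto simp: add.commute)
  \<comment> \<open>After the action of \<open>rev y\<close> is stripped, only the leftmost root
    could involve \<open>\<alpha>_p\<close> when \<open>p\<close> differs from \<open>k\<close>, so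
    no root of the three would be the sum of the other two.\<close>
  have "p = k"
  proof (rule ccontr)
    assume "p \<noteq> k"
    define v1 v2 v3 where "v1 = act [k, q] (simple_root p)" and "v2 = act [k] (simple_root q)"
      and "v3 = simple_root k"
    have "r1 = act (rev y) v1" "r2 = act (rev y) v2" "r3 = act (rev y) v3"
      using xy by (simp_all add: v1_def v2_def v3_def word_action_append)
    then have "v1 = v2 + v3 \<or> v2 = v1 + v3 \<or> v3 = v1 + v2"
      using sum act_inj[OF rev_lists[OF l(2)]] by (metis word_action_add)
    moreover have "Poly_Mapping.lookup v1 p = 1" "Poly_Mapping.lookup v2 p = 0" "Poly_Mapping.lookup v3 p = 0"
      using \<open>p \<noteq> k\<close> ne
      by (simp_all add: v1_def v2_def v3_def word_action_Cons lookup_simple_reflection lookup_simple_root)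
    ultimately show False
      by (auto simp: lookup_add)
  qed
  from l(4,5) ne(2) show False
  proof (cases rule: m_cases)
    case 1
    have "wp [k, q, k] = wp [q, k, k]"
      using wp_context[of "[]" "[k]" "[k, q]" "[q, k]"] wp_commute[OF l(5,4) 1(2)] l by simp
    then have "reduced_expression (x @ [q, k, k] @ y) w"
      using reduced_replace[of x "[k, q, k]" y w "[q, k, k]"] u(1) xy(1) \<open>p = k\<close> l by simp
    then show False
      using reduced_no_square[of "x @ [q]" k y] by (simp add: reduced_expression_def)
  next
    case 2
    have "reduced_expression (x @ [q, k, q] @ y) w"
      using reduced_replace[of x "[k, q, k]" y w "[q, k, q]"] u(1) xy(1) \<open>p = k\<close> l
        wp_braid[OF l(5,4) 2(2)] by simp
    then have "commutation_equivalent I m u (x @ [q, k, q] @ y)"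
      using fc u(1) unfolding fully_commutative_def by blast
    \<comment> \<open>Commutations preserve the number of letters \<open>k\<close>, but the braid
      lowers it from two to one in this factor.\<close>
    then have "count_list u k = count_list (x @ [q, k, q] @ y) k"
      by (rule count_list_commutation)
    then show False
      using xy(1) \<open>p = k\<close> ne by simp
  qed
qed

lemma fully_commutative_freely_braided: "fully_commutative w \<Longrightarrow> freely_braided w"
  using fully_commutative_not_contractible unfolding freely_braided_def by (auto simp: pairwise_def)

section \<open>From a length bound to finiteness\<close>

lemma well_spaced_letter:
  assumes "i \<in> I"
  shows "well_spaced bond [i]"
proof -
  have "length (pattern bond k [i]) \<le> 1" for k
    by (simp add: pattern_def)
  then show ?thesis
    unfolding well_spaced_def by (metis length_append length_Cons not_one_le_zero le_add2 Suc_le_mono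
        One_nat_def add_Suc add_Suc_right le_zero_eq nat.distinct(1))
qed

text \<open>One-letter words are well spaced, so \<open>[i]\<close> and \<open>[j]\<close> with the
  same product are commutation equivalent and contain the same letters.\<close>

lemma inj_on_letters: "inj_on (\<lambda>i. wp [i]) I"
proof (rule inj_onI)
  fix i j assume ij: "i \<in> I" "j \<in> I" "wp [i] = wp [j]"
  have g: "well_spaced bond [i]" "well_spaced bond [j]"
    using well_spaced_letter ij by blast+
  have "reduced_expression [i] (wp [i])" "reduced_expression [j] (wp [i])"
    using well_spaced_reduced[OF g(1)] well_spaced_reduced[OF g(2)] ij unfolding reduced_expression_def by simp_all
  then have "commutation_equivalent I m [i] [j]"
    using well_spaced_fully_commutative[OF g(1)] ij(1) unfolding fully_commutative_def by simp
  then have "count_list [i] i = count_list [j] i"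
    by (rule count_list_commutation)
  then show "i = j"
    by (simp split: if_splits)
qed

text \<open>Distinct letters give distinct fully commutative elements.\<close>

lemma finite_index_set:
  assumes "finite {w \<in> carrier G. fully_commutative w}"
  shows "finite I"
proof -
  have "(\<lambda>i. wp [i]) ` I \<subseteq> {w \<in> carrier G. fully_commutative w}"
  proof
    fix w assume "w \<in> (\<lambda>i. wp [i]) ` I"
    then obtain i where "i \<in> I" "w = wp [i]"
      by blast
    then show "w \<in> {w \<in> carrier G. fully_commutative w}"
      using well_spaced_fully_commutative[OF well_spaced_letter, of i] wp_closed[of "[i]"] by simp
  qed
  then show ?thesis
    using finite_imageD[OF finite_subset[OF _ assms] inj_on_letters] by blast
qed

text \<open>A well spaced word is a reduced word of a fully commutative element. All reduced words
  of an element are equally long, so the choice made in \<open>f\<close> does not affect its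
  value.\<close>

lemma well_spaced_length_bounded:
  assumes "finite {w \<in> carrier G. fully_commutative w}"
  obtains N where "\<And>u. well_spaced bond u \<Longrightarrow> u \<in> lists I \<Longrightarrow> length u \<le> N"
proof -
  define f where "f w = length (SOME u. reduced_expression u w)" for w
  have "finite (f ` {w \<in> carrier G. fully_commutative w})"
    using assms by simp
  then obtain N where N: "\<And>w. w \<in> carrier G \<Longrightarrow> fully_commutative w \<Longrightarrow> f w \<le> N"
    unfolding finite_nat_set_iff_bounded_le by blast
  have "length u \<le> N" if u: "well_spaced bond u" "u \<in> lists I" for u
  proof -
    have r: "reduced u"
      using well_spaced_reduced u .
    then have "reduced_expression u (wp u)"
      by (simp add: reduced_expression_def)
    then have "reduced_expression (SOME v. reduced_expression v (wp u)) (wp u)"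
      by (rule someI)
    then have "f (wp u) = length u"
      unfolding f_def using reduced_length[OF _ r] by (simp add: reduced_expression_def)
    then show ?thesis
      using N[OF wp_closed[OF u(2)] well_spaced_fully_commutative[OF u]] by simp
  qed
  then show thesis
    using that by blast
qed

lemma finite_freely_braided:
  assumes fin: "finite {w \<in> carrier G. fully_commutative w}"
  shows "finite {w \<in> carrier G. freely_braided w}"
proof -
  obtain N where N: "\<And>u. well_spaced bond u \<Longrightarrow> u \<in> lists I \<Longrightarrow> length u \<le> N"
    using well_spaced_length_bounded[OF fin] by blast
  have "{w \<in> carrier G. freely_braided w} \<subseteq> wp ` {u. set u \<subseteq> I \<and> length u \<le> 2 * N}"
  proof
    fix w assume "w \<in> {w \<in> carrier G. freely_braided w}"
    then have w: "w \<in> carrier G" "freely_braided w"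
      by simp_all
    then obtain u0 where "u0 \<in> lists I" "wp u0 = w"
      using generated by auto
    then obtain u where u: "reduced u" "wp u = w"
      using exists_reduced by metis
    have ul: "set u \<subseteq> I"
      using reduced_lists[OF u(1)] by auto
    have "labelled m u \<in> {labelled m u | u. reduced_expression u w}"
      using u by (auto simp: reduced_expression_def)
    from braid_closed.well_spaced_thinning[OF freely_braided_closed[OF w(2)] this]
    obtain v where v: "well_spaced bond v" "set v \<subseteq> fst ` set (labelled m u)" "length u \<le> 2 * length v"
      by auto
    have "set v \<subseteq> set u"
      using v(2) by (metis list.set_map map_fst_labelled)
    then have "v \<in> lists I"
      using ul by auto
    then have "length u \<le> 2 * N"
      using N[OF v(1)] v(3) by fastforce
    then show "w \<in> wp ` {u. set u \<subseteq> I \<and> length u \<le> 2 * N}"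
      using u(2) ul by blast
  qed
  then show ?thesis
    using finite_lists_length_le[OF finite_index_set[OF fin]] finite_subset by blast
qed
end

theorem theorem3p3p3:
  fixes G :: "('g, 'b) monoid_scheme"
    and I :: "'i set" and m :: "'i \<Rightarrow> 'i \<Rightarrow> nat" and s :: "'i \<Rightarrow> 'g"
  assumes "coxeter_system G I m s"
    and "simply_laced I m"
  shows "finite {w \<in> carrier G. coxeter_system.freely_braided G I m s w} \<longleftrightarrow>
         finite {w \<in> carrier G. coxeter_system.fully_commutative G I m s w}"
proof -
  interpret simply_laced_system G I m s
    using assms by (simp add: simply_laced_system_def simply_laced_system_axioms_def)
  have "finite {w \<in> carrier G. fully_commutative w}" if "finite {w \<in> carrier G. freely_braided w}"
    using that by (rule rev_finite_subset) (use fully_commutative_freely_braided in blast)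
  then show ?thesis
    using finite_freely_braided by blast
qed

end
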